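(* Let $H_1,\dots,H_N:\mathbb{R}\to\mathbb{R}$ be continuous, quasi-convex and coercive, let $A\in\mathbb{R}\cup\{-\infty\}$, and consider the junction function $F_A$ (which is continuous and non-increasing with respect to each variable). Let $u_0:J\to\mathbb{R}$ be uniformly continuous. Let $T>0$, and let $u$ be a relaxed sub-solution and $v$ a relaxed super-solution on $[0,T)\times J$ of $$u_t+H_i(u_x)=0 \ \text{ for } t>0,\ x\in J_i^*\ (i=1,\dots,N),\qquad u_t+F_A(u_x)=0\ \text{ for } t>0,\ x=0,$$ with initial condition $u(0,x)=u_0(x)$ for $x\in J$. Assume that for some $C_T>0$, $$u(t,x)\le C_T(1+d(0,x)),\qquad v(t,x)\ge -C_T(1+d(0,x))\qquad\text{for all }(t,x)\in[0,T)\times J.$$ Then $u\le v$ in $[0,T)\times J$.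
   Context: Junction: $N\ge 1$; $J=\bigcup_{i=1}^N J_i$, where each branch $J_i$ is isometric to $[0,+\infty)$ and $J_i\cap J_j=\{0\}$ for $i\ne j$; $J_i^*=J_i\setminus\{0\}$. The geodesic distance is $d(x,y)=|x-y|$ if $x,y$ are on the same branch and $|x|+|y|$ otherwise. $J_T=(0,T)\times J$. $\partial_i u(x)$ is the derivative at $x\in J_i$; $u_x(x)=\partial_i u(x)$ if $x\in J_i^*$ and $u_x(0)=(\partial_1u(0),\dots,\partial_Nu(0))$. Hamiltonians: $H_i$ is quasi-convex if its sub-level sets are convex; coercive means $H_i(p)\to+\infty$ as $|p|\to+\infty$. Then there is $p_i^0$ with $H_i$ nonincreasing on $(-\infty,p_i^0]$ and nondecreasing on $[p_i^0,+\infty)$. $H_i^-(q)=H_i(q)$ if $q\le p_i^0$, $H_i^-(q)=H_i(p_i^0)$ if $q>p_i^0$. $F_A(p)=\max\big(A,\max_{i}H_i^-(p_i)\big)$ for $p=(p_1,\dots,p_N)$. Test functions: $C^1(J_T)$ is the set of $\varphi\in C(J_T)$ whose restriction to $(0,T)\times J_i$ is $C^1$ for every $i$. $\varphi$ touches $u$ from above (resp. below) at a point if $u-\varphi$ has a local maximum (resp. minimum) there. For a locally bounded $u$ on $[0,T)\times J$, $u^*$ and $u_*$ are its upper and lower semi-continuous envelopes. Relaxed sub-solution (resp. super-solution) on $(0,T)\times J$ for a junction function $F$: for every $\varphi\in C^1(J_T)$ touching $u^*$ from above (resp. $u_*$ from below) at $(t_0,x_0)\in J_T$: if $x_0\in J_i^*$,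 $\varphi_t+H_i(\varphi_x)\le0$ (resp. $\ge0$) at $(t_0,x_0)$; if $x_0=0$, either $\varphi_t+F(\varphi_x)\le0$ (resp. $\ge0$) or $\varphi_t+H_i(\partial_i\varphi)\le0$ (resp. $\ge0$) for some $i$, at $(t_0,0)$. It is a sub-solution (resp. super-solution) on $[0,T)\times J$ with initial datum $u_0$ if in addition $u^*(0,x)\le u_0(x)$ (resp. $u_*(0,x)\ge u_0(x)$) for all $x\in J$. Here $F=F_A$. *)

theory Defs
  imports "HOL-Analysis.Analysis"
begin

section \<open>The junction\<close>

text \<open>
  The \<open>N\<close> branches are indexed by a finite type (so \<open>N = CARD('n)\<close>, and \<open>N \<ge> 1\<close> since types are
  nonempty).  The junction is realised as the union of the nonnegative coordinate half-axes of
  \<open>\<real>\<^sup>N\<close>, but carries the geodesic distance, not the Euclidean one.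
\<close>

typedef (overloaded) 'n junction = "{x :: real ^ 'n::finite. \<exists>i. \<exists>s\<ge>0. x = axis i s}"
  by (auto intro!: exI[of _ 0])

text \<open>The point at distance \<open>s\<close> from the origin on branch \<open>i\<close>; only used for \<open>s \<ge> 0\<close>.\<close>

definition jpt :: "'n::finite \<Rightarrow> real \<Rightarrow> 'n junction" where
  "jpt i s = Abs_junction (axis i s)"

definition branch :: "'n::finite \<Rightarrow> 'n junction set" where
  "branch i = jpt i ` {0..}"

definition radius :: "'n::finite junction \<Rightarrow> real" where
  "radius x = norm (Rep_junction x)"

instantiation junction :: (finite) zero
begin
definition zero_junction :: "'a junction" where
  "0 = Abs_junction 0"
instance ..
end

definition open_branch :: "'n::finite \<Rightarrow> 'n junction set" where
  "open_branch i = branch i - {0}"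

lemma Rep_jpt: "s \<ge> 0 \<Longrightarrow> Rep_junction (jpt i s) = axis i s"
  unfolding jpt_def by (rule Abs_junction_inverse) auto

lemma axis_zero: "axis i (0::real) = 0"
  by (simp add: axis_eq_0_iff)

lemma jpt_zero: "jpt i 0 = 0"
  by (simp add: jpt_def zero_junction_def axis_zero)

lemma radius_jpt: "s \<ge> 0 \<Longrightarrow> radius (jpt i s) = s"
  by (simp add: radius_def Rep_jpt norm_eq_sqrt_inner inner_axis_axis)

lemma jpt_eq_iff:
  assumes "r \<ge> 0" "s \<ge> 0"
  shows "jpt i r = jpt j s \<longleftrightarrow> r = s \<and> (i = j \<or> r = 0)"
  using assms by (auto simp: Rep_junction_inject[symmetric] Rep_jpt axis_eq_axis axis_zero)

lemma jpt_eq_0_iff: "s \<ge> 0 \<Longrightarrow> jpt i s = 0 \<longleftrightarrow> s = 0"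
  using jpt_eq_iff[of s 0 i i] by (simp add: jpt_zero)

lemma jpt_cases:
  obtains i s where "s \<ge> 0" "x = jpt i s"
  using Rep_junction[of x] by (auto simp: jpt_def) (metis Rep_junction_inverse)

lemma jpt_in_branch_iff:
  assumes "s \<ge> 0"
  shows "jpt i s \<in> branch j \<longleftrightarrow> i = j \<or> s = 0"
  using assms by (auto simp: branch_def image_iff jpt_eq_iff)

lemma branch_Int_branch: "i \<noteq> j \<Longrightarrow> branch i \<inter> branch j = {0}"
proof -
  assume "i \<noteq> j"
  have "x \<in> branch i \<inter> branch j \<longleftrightarrow> x = 0" for x
  proof -
    obtain k s where "s \<ge> 0" "x = jpt k s" by (rule jpt_cases)
    with \<open>i \<noteq> j\<close> show ?thesis
      by (auto simp: jpt_in_branch_iff jpt_eq_0_iff)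
  qed
  then show ?thesis by blast
qed

lemma Union_branch: "(\<Union>i. branch i) = UNIV"
  by (auto simp: branch_def) (metis atLeast_iff imageI jpt_cases)

instantiation junction :: (finite) metric_space
begin

definition dist_junction :: "'a junction \<Rightarrow> 'a junction \<Rightarrow> real" where
  "dist x y = (if \<exists>i. x \<in> branch i \<and> y \<in> branch i then \<bar>radius x - radius y\<bar>
               else radius x + radius y)"

definition uniformity_junction :: "('a junction \<times> 'a junction) filter" where
  "(uniformity :: ('a junction \<times> 'a junction) filter) =
     (INF e\<in>{0<..}. principal {(x, y). dist x y < e})"

definition open_junction :: "'a junction set \<Rightarrow> bool" where
  "open (U :: 'a junction set) \<longleftrightarrow>
     (\<forall>x\<in>U. eventually (\<lambda>(x', y). x' = x \<longrightarrow> y \<in> U) uniformity)"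

lemma dist_jpt:
  assumes "r \<ge> 0" "s \<ge> 0"
  shows "dist (jpt i r) (jpt j s) = (if i = j then \<bar>r - s\<bar> else r + s)"
  using assms by (auto simp: dist_junction_def radius_jpt jpt_in_branch_iff)

instance
proof
  show "uniformity = (INF e\<in>{0<..}. principal {(x :: 'a junction, y). dist x y < e})"
    by (rule uniformity_junction_def)
  show "open U \<longleftrightarrow> (\<forall>x\<in>U. eventually (\<lambda>(x', y). x' = x \<longrightarrow> y \<in> U) uniformity)"
    for U :: "'a junction set"
    by (rule open_junction_def)
  show "dist x y = 0 \<longleftrightarrow> x = y" for x y :: "'a junction"
    by (cases x rule: jpt_cases; cases y rule: jpt_cases) (auto simp: dist_jpt jpt_eq_iff)
  show "dist x y \<le> dist x z + dist y z" for x y z :: "'a junction"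
    by (cases x rule: jpt_cases; cases y rule: jpt_cases; cases z rule: jpt_cases)
      (auto simp: dist_jpt)
qed

end

section \<open>Hamiltonians and flux-limited junction functions\<close>

definition quasi_convex :: "(real \<Rightarrow> real) \<Rightarrow> bool" where
  "quasi_convex h \<longleftrightarrow> (\<forall>c. convex {p. h p \<le> c})"

definition coercive :: "(real \<Rightarrow> real) \<Rightarrow> bool" where
  "coercive h \<longleftrightarrow> filterlim h at_top at_infinity"

definition turning_point :: "(real \<Rightarrow> real) \<Rightarrow> real \<Rightarrow> bool" where
  "turning_point h p0 \<longleftrightarrow> antimono_on {..p0} h \<and> mono_on {p0..} h"

text \<open>The choice of \<open>p0\<close> is immaterial: see \<open>ex_turning_point\<close> and \<open>dec_part_eq\<close> below.\<close>

definition dec_part :: "(real \<Rightarrow> real) \<Rightarrow> real \<Rightarrow> real" where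
  "dec_part h q = (let p0 = (SOME p0. turning_point h p0) in if q \<le> p0 then h q else h p0)"

lemma ex_turning_point:
  assumes cont: "continuous_on UNIV h" and qc: "quasi_convex h" and co: "coercive h"
  shows "\<exists>p0. turning_point h p0"
proof -
  have "eventually (\<lambda>p. h p \<ge> h 0) at_infinity"
    using co by (auto simp: coercive_def filterlim_at_top)
  then obtain b where b: "\<And>p. norm p \<ge> b \<Longrightarrow> h p \<ge> h 0"
    by (auto simp: eventually_at_infinity)
  define M where "M = max b 0"
  have "continuous_on {-M..M} h" "{-M..M} \<noteq> {}"
    using cont continuous_on_subset by (auto simp: M_def)
  then obtain p0 where p0: "p0 \<in> {-M..M}" "\<And>p. p \<in> {-M..M} \<Longrightarrow> h p0 \<le> h p"
    using continuous_attains_inf[of "{-M..M}" h] by auto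
  have min: "h p0 \<le> h p" for p
  proof (cases "p \<in> {-M..M}")
    case False
    then have "norm p \<ge> b" by (auto simp: M_def)
    then have "h 0 \<le> h p" by (rule b)
    moreover have "h p0 \<le> h 0" by (rule p0) (auto simp: M_def)
    ultimately show ?thesis by simp
  qed (use p0 in auto)
  have between: "h y \<le> max (h x) (h z)" if "x \<le> y" "y \<le> z" for x y z
  proof -
    have "is_interval {p. h p \<le> max (h x) (h z)}"
      using qc by (auto simp: quasi_convex_def is_interval_convex_1)
    then have "y \<in> {p. h p \<le> max (h x) (h z)}"
      by (rule mem_is_interval_1_I[OF _ _ _ that]) auto
    then show ?thesis by simp
  qed
  have "h y \<le> h x" if "x \<le> y" "y \<le> p0" for x y
    using between[OF that] min[of x] by simp
  moreover have "h x \<le> h y" if "p0 \<le> x" "x \<le> y" for x y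
    using between[OF that] min[of y] by simp
  ultimately have "turning_point h p0"
    by (simp add: turning_point_def monotone_on_def)
  then show ?thesis by blast
qed

lemma dec_part_eq:
  assumes p0: "turning_point h p0"
  shows "dec_part h q = (if q \<le> p0 then h q else h p0)"
proof -
  have eq: "(if q \<le> a then h q else h a) = (if q \<le> b then h q else h b)"
    if "a \<le> b" "turning_point h a" "turning_point h b" for a b
  proof -
    have "h x = h y" if "a \<le> x" "x \<le> y" "y \<le> b" for x y
      using that \<open>turning_point h a\<close> \<open>turning_point h b\<close>
      by (auto simp: turning_point_def monotone_on_def intro!: antisym)
    then show ?thesis using that by (auto simp: not_le)
  qed
  have "turning_point h (SOME p0. turning_point h p0)"
    using p0 by (rule someI)
  with p0 eq show ?thesis
    unfolding dec_part_def Let_def by (metis linear)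
qed

text \<open>
  The flux limiter \<open>A\<close> ranges over \<open>\<real> \<union> {-\<infinity>}\<close>, encoded as an extended real different
  from \<open>\<infinity>\<close>; the maximum below is then finite.
\<close>

definition flux_limited :: "('n::finite \<Rightarrow> real \<Rightarrow> real) \<Rightarrow> ereal \<Rightarrow> ('n \<Rightarrow> real) \<Rightarrow> real" where
  "flux_limited H A p = real_of_ereal (max A (ereal (MAX i. dec_part (H i) (p i))))"

section \<open>Semicontinuous envelopes and test functions\<close>

definition locally_bounded_on :: "'a::topological_space set \<Rightarrow> ('a \<Rightarrow> real) \<Rightarrow> bool" where
  "locally_bounded_on S u \<longleftrightarrow> (\<forall>z\<in>S. \<exists>U. open U \<and> z \<in> U \<and> bounded (u ` (U \<inter> S)))"

text \<open>
  Envelopes relative to \<open>S\<close>.  The filter includes the point \<open>z\<close> itself, unlike \<open>at z within S\<close>.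
  If \<open>u\<close> is locally bounded on \<open>S\<close> and \<open>z \<in> S\<close>, the limits are finite.
\<close>

definition usc_env :: "'a::topological_space set \<Rightarrow> ('a \<Rightarrow> real) \<Rightarrow> 'a \<Rightarrow> real" where
  "usc_env S u z = real_of_ereal (Limsup (inf (nhds z) (principal S)) (\<lambda>y. ereal (u y)))"

definition lsc_env :: "'a::topological_space set \<Rightarrow> ('a \<Rightarrow> real) \<Rightarrow> 'a \<Rightarrow> real" where
  "lsc_env S u z = real_of_ereal (Liminf (inf (nhds z) (principal S)) (\<lambda>y. ereal (u y)))"

definition C1_on :: "'a::real_normed_vector set \<Rightarrow> ('a \<Rightarrow> real) \<Rightarrow> bool" where
  "C1_on S f \<longleftrightarrow> (\<exists>f' :: 'a \<Rightarrow> 'a \<Rightarrow>\<^sub>L real.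
     (\<forall>z\<in>S. (f has_derivative blinfun_apply (f' z)) (at z within S)) \<and> continuous_on S f')"

definition test_functions :: "real \<Rightarrow> (real \<times> 'n::finite junction \<Rightarrow> real) set" where
  "test_functions T = {\<phi>. continuous_on ({0<..<T} \<times> UNIV) \<phi> \<and>
     (\<forall>i. C1_on ({0<..<T} \<times> {0..}) (\<lambda>(t, s). \<phi> (t, jpt i s)))}"

definition time_deriv :: "(real \<times> 'n::finite junction \<Rightarrow> real) \<Rightarrow> real \<Rightarrow> 'n junction \<Rightarrow> real" where
  "time_deriv \<phi> t x = deriv (\<lambda>\<tau>. \<phi> (\<tau>, x)) t"

text \<open>Meaningful for \<open>x \<in> branch i\<close>; at \<open>x = 0\<close> it is the one-sided derivative.\<close>

definition branch_deriv ::
  "'n::finite \<Rightarrow> (real \<times> 'n junction \<Rightarrow> real) \<Rightarrow> real \<Rightarrow> 'n junction \<Rightarrow> real" where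
  "branch_deriv i \<phi> t x = vector_derivative (\<lambda>s. \<phi> (t, jpt i s)) (at (radius x) within {0..})"

definition touches_above ::
  "real \<Rightarrow> (real \<times> 'n::finite junction \<Rightarrow> real) \<Rightarrow> (real \<times> 'n junction \<Rightarrow> real) \<Rightarrow>
   real \<times> 'n junction \<Rightarrow> bool" where
  "touches_above T \<phi> w z \<longleftrightarrow>
     eventually (\<lambda>y. w y - \<phi> y \<le> w z - \<phi> z) (at z within {0<..<T} \<times> UNIV)"

definition touches_below ::
  "real \<Rightarrow> (real \<times> 'n::finite junction \<Rightarrow> real) \<Rightarrow> (real \<times> 'n junction \<Rightarrow> real) \<Rightarrow>
   real \<times> 'n junction \<Rightarrow> bool" where
  "touches_below T \<phi> w z \<longleftrightarrow>
     eventually (\<lambda>y. w y - \<phi> y \<ge> w z - \<phi> z) (at z within {0<..<T} \<times> UNIV)"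

section \<open>Relaxed sub- and super-solutions\<close>

definition relaxed_subsolution ::
  "real \<Rightarrow> ('n::finite \<Rightarrow> real \<Rightarrow> real) \<Rightarrow> (('n \<Rightarrow> real) \<Rightarrow> real) \<Rightarrow>
   (real \<times> 'n junction \<Rightarrow> real) \<Rightarrow> bool" where
  "relaxed_subsolution T H F u \<longleftrightarrow>
     locally_bounded_on ({0..<T} \<times> UNIV) u \<and>
     (\<forall>\<phi>\<in>test_functions T. \<forall>t\<in>{0<..<T}. \<forall>x.
        touches_above T \<phi> (usc_env ({0..<T} \<times> UNIV) u) (t, x) \<longrightarrow>
          (\<forall>i. x \<in> open_branch i \<longrightarrow> time_deriv \<phi> t x + H i (branch_deriv i \<phi> t x) \<le> 0) \<and>
          (x = 0 \<longrightarrow>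
             time_deriv \<phi> t 0 + F (\<lambda>i. branch_deriv i \<phi> t 0) \<le> 0 \<or>
             (\<exists>i. time_deriv \<phi> t 0 + H i (branch_deriv i \<phi> t 0) \<le> 0)))"

definition relaxed_supersolution ::
  "real \<Rightarrow> ('n::finite \<Rightarrow> real \<Rightarrow> real) \<Rightarrow> (('n \<Rightarrow> real) \<Rightarrow> real) \<Rightarrow>
   (real \<times> 'n junction \<Rightarrow> real) \<Rightarrow> bool" where
  "relaxed_supersolution T H F v \<longleftrightarrow>
     locally_bounded_on ({0..<T} \<times> UNIV) v \<and>
     (\<forall>\<phi>\<in>test_functions T. \<forall>t\<in>{0<..<T}. \<forall>x.
        touches_below T \<phi> (lsc_env ({0..<T} \<times> UNIV) v) (t, x) \<longrightarrow>
          (\<forall>i. x \<in> open_branch i \<longrightarrow> time_deriv \<phi> t x + H i (branch_deriv i \<phi> t x) \<ge> 0) \<and>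
          (x = 0 \<longrightarrow>
             time_deriv \<phi> t 0 + F (\<lambda>i. branch_deriv i \<phi> t 0) \<ge> 0 \<or>
             (\<exists>i. time_deriv \<phi> t 0 + H i (branch_deriv i \<phi> t 0) \<ge> 0)))"

definition relaxed_subsolution_from ::
  "('n::finite junction \<Rightarrow> real) \<Rightarrow> real \<Rightarrow> ('n \<Rightarrow> real \<Rightarrow> real) \<Rightarrow> (('n \<Rightarrow> real) \<Rightarrow> real) \<Rightarrow>
   (real \<times> 'n junction \<Rightarrow> real) \<Rightarrow> bool" where
  "relaxed_subsolution_from u0 T H F u \<longleftrightarrow>
     relaxed_subsolution T H F u \<and> (\<forall>x. usc_env ({0..<T} \<times> UNIV) u (0, x) \<le> u0 x)"

definition relaxed_supersolution_from ::
  "('n::finite junction \<Rightarrow> real) \<Rightarrow> real \<Rightarrow> ('n \<Rightarrow> real \<Rightarrow> real) \<Rightarrow> (('n \<Rightarrow> real) \<Rightarrow> real) \<Rightarrow>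
   (real \<times> 'n junction \<Rightarrow> real) \<Rightarrow> bool" where
  "relaxed_supersolution_from u0 T H F v \<longleftrightarrow>
     relaxed_supersolution T H F v \<and> (\<forall>x. lsc_env ({0..<T} \<times> UNIV) v (0, x) \<ge> u0 x)"

end

theory Submission imports Defs begin

text \<open>
  Comparison is proved by contradiction with viscosity test functions. Suppose that \<open>u\<^sup>* - v\<^sub>*\<close> is
  positive somewhere. Barriers that use the linear modulus of the uniformly continuous \<open>u0\<close>
  (lemmas \<open>barrier\<close> and \<open>uniformly_continuous_junction_modulus\<close>) show that, up to a small error,
  \<open>u\<^sup>*(t, x)\<close> is at most \<open>u0(x) + K t\<close> and \<open>v\<^sub>*(t, x)\<close> is at least \<open>u0(x) - K t\<close>. Hence \<open>u\<^sup>*(r, x)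
  - v\<^sub>*(s, x)\<close> is bounded above, and after subtracting

  \<open>\<eta> / (T - r) + \<eta> / (T - s) + (r - s)\<^sup>2 / (2 * \<epsilon>) + \<alpha> * d(0, x)\<^sup>2\<close>

  it has a positive maximum, at positive times \<open>r0\<close>, \<open>s0\<close> and some point \<open>x0\<close>. The time variable
  is doubled but the space variable is not.

  If \<open>x0\<close> lies in the interior of a branch, the space variable is doubled as well, locally around
  \<open>x0\<close>, which is the classical argument (\<open>interior_doubling\<close>).

  If \<open>x0\<close> is the vertex, doubling the space variable would put the two points on different
  branches or at the vertex and on a branch, where the inequalities cannot be compared directly.
  Instead, the sub-solution is examined in isolation (\<open>vertex_slopes\<close>). Let \<open>\<lambda>\<close> be the time
  derivative of its test function at \<open>r0\<close>. On each branch the sub-solution, maximised over times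
  near \<open>r0\<close>, has a finite lower slope \<open>p i\<close> at the vertex, and \<open>H i (p i) \<le> - \<lambda>\<close>; moreover \<open>A \<le> -
  \<lambda>\<close>. By maximality \<open>v\<^sub>*\<close> lies above the lines of slopes slightly less than \<open>p i\<close>, so it may be
  tested with them. This requires the value of some \<open>H i\<close> or of \<open>F\<^sub>A\<close> at these slopes to be at
  least \<open>- \<mu>\<close>, with the time derivative \<open>\<mu>\<close> of its test function. But \<open>F\<^sub>A(p)\<close> never exceeds the
  maximum of \<open>A\<close> and the \<open>H i (p i)\<close>, and the terms with \<open>\<eta>\<close> give \<open>- \<lambda> < - \<mu>\<close>: a contradiction
  (\<open>no_maximum_at_vertex\<close>).

  All estimates are carried out in branch coordinates, and the super-solution is replaced by the
  sub-solution \<open>- v\<^sub>*\<close> of the dual problem.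
\<close>

section \<open>Upper semicontinuous functions on a set\<close>

definition usc_on :: "'a::metric_space set \<Rightarrow> ('a \<Rightarrow> real) \<Rightarrow> bool" where
  "usc_on S f \<longleftrightarrow> (\<forall>z\<in>S. \<forall>c>f z. \<exists>e>0. \<forall>y\<in>S. dist y z < e \<longrightarrow> f y < c)"

lemma usc_onD:
  assumes "usc_on S f" "z \<in> S" "f z < c"
  obtains e where "e > 0" "\<And>y. y \<in> S \<Longrightarrow> dist y z < e \<Longrightarrow> f y < c"
  using assms unfolding usc_on_def by blast

lemma usc_on_subset: "usc_on S f \<Longrightarrow> T \<subseteq> S \<Longrightarrow> usc_on T f"
  unfolding usc_on_def by (meson subset_iff)

lemma continuous_imp_usc_on:
  assumes "continuous_on S f"
  shows "usc_on S f"
  unfolding usc_on_def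
proof (intro ballI allI impI)
  fix z c assume z: "z \<in> S" "f z < c"
  then obtain e where "e > 0" "\<forall>y\<in>S. dist y z < e \<longrightarrow> dist (f y) (f z) < c - f z"
    using assms unfolding continuous_on_iff by (metis diff_gt_0_iff_gt)
  then show "\<exists>e>0. \<forall>y\<in>S. dist y z < e \<longrightarrow> f y < c"
    by (intro exI[of _ e]) (auto simp: dist_real_def abs_less_iff)
qed

lemma usc_on_add:
  assumes f: "usc_on S f" and g: "usc_on S g"
  shows "usc_on S (\<lambda>z. f z + g z)"
  unfolding usc_on_def
proof (intro ballI allI impI)
  fix z c assume z: "z \<in> S" "f z + g z < c"
  define h where "h = (c - f z - g z) / 2"
  have h: "h > 0" using z by (simp add: h_def)
  obtain e1 where e1: "e1 > 0" "\<And>y. y \<in> S \<Longrightarrow> dist y z < e1 \<Longrightarrow> f y < f z + h"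
    using usc_onD[OF f z(1), of "f z + h"] h by auto
  obtain e2 where e2: "e2 > 0" "\<And>y. y \<in> S \<Longrightarrow> dist y z < e2 \<Longrightarrow> g y < g z + h"
    using usc_onD[OF g z(1), of "g z + h"] h by auto
  have "f y + g y < c" if "y \<in> S" "dist y z < min e1 e2" for y
    using e1(2)[of y] e2(2)[of y] that by (simp add: h_def field_simps)
  then show "\<exists>e>0. \<forall>y\<in>S. dist y z < e \<longrightarrow> f y + g y < c"
    using e1(1) e2(1) by (intro exI[of _ "min e1 e2"]) auto
qed

lemma usc_on_diff_continuous:
  "usc_on S f \<Longrightarrow> continuous_on S g \<Longrightarrow> usc_on S (\<lambda>z. f z - g z)"
  using usc_on_add[OF _ continuous_imp_usc_on[OF continuous_on_minus]] by force

lemma usc_on_compose: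
  assumes f: "usc_on S f" and g: "continuous_on T g" "g ` T \<subseteq> S"
  shows "usc_on T (\<lambda>x. f (g x))"
  unfolding usc_on_def
proof (intro ballI allI impI)
  fix z c assume z: "z \<in> T" "f (g z) < c"
  then obtain e where e: "e > 0" "\<And>y. y \<in> S \<Longrightarrow> dist y (g z) < e \<Longrightarrow> f y < c"
    using usc_onD[OF f, of "g z" c] g(2) by blast
  obtain d where "d > 0" "\<forall>y\<in>T. dist y z < d \<longrightarrow> dist (g y) (g z) < e"
    using g(1) z(1) e(1) unfolding continuous_on_iff by metis
  then show "\<exists>e>0. \<forall>y\<in>T. dist y z < e \<longrightarrow> f (g y) < c"
    using e(2) g(2) by (intro exI[of _ d]) auto
qed

text \<open>
  Semicontinuity is used through this limit form: a lower bound along approximate maximisers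
  survives at their cluster points.
\<close>

lemma usc_on_limit:
  fixes z :: "nat \<Rightarrow> 'a::metric_space"
  assumes f: "usc_on S f" and z: "\<And>n. z n \<in> S" "z \<longlonglongrightarrow> l" "l \<in> S"
    and c: "c \<longlonglongrightarrow> k" "\<And>n. c n \<le> f (z n)"
  shows "k \<le> f l"
proof (rule ccontr)
  assume "\<not> k \<le> f l"
  then have m: "f l < (f l + k) / 2" "(f l + k) / 2 < k" by auto
  obtain e where e: "e > 0" "\<And>y. y \<in> S \<Longrightarrow> dist y l < e \<Longrightarrow> f y < (f l + k) / 2"
    using usc_onD[OF f z(3) m(1)] by metis
  have "eventually (\<lambda>n. dist (z n) l < e) sequentially"
    using z(2) e(1) by (rule tendstoD)
  moreover have "eventually (\<lambda>n. (f l + k) / 2 < c n) sequentially"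
    using c(1) m(2) by (rule order_tendstoD)
  ultimately have "eventually (\<lambda>n. False) sequentially"
    by eventually_elim (use e(2) z(1) c(2) in \<open>smt (verit)\<close>)
  then show False by simp
qed

lemma finite_has_maximal_arg:
  fixes h :: "'b \<Rightarrow> real"
  assumes "finite D" "D \<noteq> {}"
  shows "\<exists>z\<in>D. \<forall>y\<in>D. h y \<le> h z"
proof -
  have "Max (h ` D) \<in> h ` D" using assms by (intro Max_in) auto
  then obtain z where "z \<in> D" "h z = Max (h ` D)" by auto
  then show ?thesis using assms by (intro bexI[of _ z]) auto
qed

lemma usc_on_attains_max:
  assumes S: "compact S" "S \<noteq> {}" and f: "usc_on S f"
  shows "\<exists>z\<in>S. \<forall>y\<in>S. f y \<le> f z"
proof (rule ccontr)
  assume "\<not> ?thesis"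
  then have "\<forall>z\<in>S. \<exists>w e. w \<in> S \<and> e > 0 \<and> (\<forall>y\<in>S. dist y z < e \<longrightarrow> f y < f w)"
    using f unfolding usc_on_def by (meson not_le)
  then obtain w e where w: "\<And>z. z \<in> S \<Longrightarrow> w z \<in> S" and e: "\<And>z. z \<in> S \<Longrightarrow> e z > 0"
    and less: "\<And>z y. z \<in> S \<Longrightarrow> y \<in> S \<Longrightarrow> dist y z < e z \<Longrightarrow> f y < f (w z)"
    by metis
  have "S \<subseteq> (\<Union>z\<in>S. ball z (e z))" using e by force
  then obtain D where D: "D \<subseteq> S" "finite D" "S \<subseteq> (\<Union>z\<in>D. ball z (e z))"
    using compactE_image[OF S(1), of S "\<lambda>z. ball z (e z)"] by (metis open_ball)
  have "D \<noteq> {}" using D S(2) by auto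
  then obtain z where z: "z \<in> D" "\<And>y. y \<in> D \<Longrightarrow> f (w y) \<le> f (w z)"
    using finite_has_maximal_arg[OF D(2), of "\<lambda>y. f (w y)"] by blast
  obtain y where y: "y \<in> D" "dist (w z) y < e y"
    using D(3) w[OF subsetD[OF D(1) z(1)]] by (auto simp: dist_commute)
  have "y \<in> S" "w z \<in> S" using D(1) y(1) w z(1) by auto
  then have "f (w z) < f (w y)" using less[of y "w z"] y(2) by (simp add: dist_commute)
  with z(2)[OF y(1)] show False by simp
qed

text \<open>
  A function on the junction is a family of functions on half-lines, indexed by the branches.
  Maxima over the junction therefore appear as maxima over both the index and the coordinate.
\<close>

lemma usc_family_attains_max:
  fixes f :: "'n::finite \<Rightarrow> 'a::metric_space \<Rightarrow> real"
  assumes K: "\<And>i. compact (K i)" "\<And>i. K i \<noteq> {}" and f: "\<And>i. usc_on (K i) (f i)"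
  shows "\<exists>i. \<exists>z\<in>K i. \<forall>j. \<forall>y\<in>K j. f j y \<le> f i z"
proof -
  have "\<forall>i. \<exists>z\<in>K i. \<forall>y\<in>K i. f i y \<le> f i z"
    by (intro allI usc_on_attains_max K f)
  then obtain z where "\<forall>i. z i \<in> K i \<and> (\<forall>y\<in>K i. f i y \<le> f i (z i))"
    unfolding Bex_def by (rule choice[THEN exE])
  then have z: "\<And>i. z i \<in> K i" "\<And>i y. y \<in> K i \<Longrightarrow> f i y \<le> f i (z i)"
    by auto
  obtain i where "\<And>j. f j (z j) \<le> f i (z i)"
    using finite_has_maximal_arg[of UNIV "\<lambda>j. f j (z j)"] by auto
  then have "f j y \<le> f i (z i)" if "y \<in> K j" for j y
    using z(2)[OF that] by (meson order_trans)
  then show ?thesis using z(1) by blast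
qed

lemma usc_family_attains_max_superlevel:
  fixes f :: "'n::finite \<Rightarrow> 'a::metric_space \<Rightarrow> real"
  assumes f: "\<And>i. usc_on (S i) (f i)" and K: "\<And>i. compact (K i)" "\<And>i. K i \<noteq> {}" "\<And>i. K i \<subseteq> S i"
    and z0: "z0 \<in> K i0" and out: "\<And>j y. y \<in> S j \<Longrightarrow> y \<notin> K j \<Longrightarrow> f j y \<le> f i0 z0"
  shows "\<exists>i. \<exists>z\<in>K i. \<forall>j. \<forall>y\<in>S j. f j y \<le> f i z"
proof -
  obtain i z where z: "z \<in> K i" "\<And>j y. y \<in> K j \<Longrightarrow> f j y \<le> f i z"
    using usc_family_attains_max[of K f, OF K(1,2) usc_on_subset[OF f K(3)]] by blast
  then have "f j y \<le> f i z" if "y \<in> S j" for j y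
    using out[OF that] z(2)[OF z0] z(2)[of y j] by (cases "y \<in> K j") auto
  with z(1) show ?thesis by blast
qed

section \<open>Semicontinuous envelopes\<close>

context
  fixes S :: "'a::metric_space set" and u :: "'a \<Rightarrow> real"
  assumes lb: "locally_bounded_on S u"
begin

text \<open>
  Local boundedness keeps the upper limit away from \<open>\<plusminus>\<infinity>\<close>, which the conversion back to the reals
  would silently turn into \<open>0\<close>.
\<close>

lemma Limsup_eq_usc_env:
  assumes z: "z \<in> S"
  shows "Limsup (inf (nhds z) (principal S)) (\<lambda>y. ereal (u y)) = ereal (usc_env S u z)"
proof -
  let ?F = "inf (nhds z) (principal S)"
  obtain N where N: "open N" "z \<in> N" "bounded (u ` (N \<inter> S))"
    using lb z unfolding locally_bounded_on_def by blast
  then obtain B where B: "\<And>y. y \<in> N \<inter> S \<Longrightarrow> \<bar>u y\<bar> \<le> B"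
    by (auto simp: bounded_iff)
  have ev: "eventually (\<lambda>y. \<bar>u y\<bar> \<le> B) ?F"
    unfolding eventually_inf_principal eventually_nhds using N B by blast
  have "?F \<noteq> bot"
    using z eventually_nhds_x_imp_x[of "\<lambda>x. x \<notin> S" z]
    by (auto simp: trivial_limit_def eventually_inf_principal)
  then have "ereal (- B) \<le> Limsup ?F (\<lambda>y. ereal (u y))"
    by (rule le_Limsup) (rule eventually_mono[OF ev], auto)
  moreover have "Limsup ?F (\<lambda>y. ereal (u y)) \<le> ereal B"
    by (rule Limsup_bounded) (rule eventually_mono[OF ev], auto)
  ultimately show ?thesis
    unfolding usc_env_def by (cases "Limsup ?F (\<lambda>y. ereal (u y))") auto
qed

lemma usc_env_lessD:
  assumes "z \<in> S" "usc_env S u z < c"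
  shows "eventually (\<lambda>y. y \<in> S \<longrightarrow> u y < c) (nhds z)"
proof -
  have "Limsup (inf (nhds z) (principal S)) (\<lambda>y. ereal (u y)) < ereal c"
    using assms by (simp add: Limsup_eq_usc_env)
  from Limsup_lessD[OF this] show ?thesis
    by (simp add: eventually_inf_principal)
qed

lemma usc_env_le:
  assumes "z \<in> S" "eventually (\<lambda>y. y \<in> S \<longrightarrow> u y \<le> c) (nhds z)"
  shows "usc_env S u z \<le> c"
proof -
  have "Limsup (inf (nhds z) (principal S)) (\<lambda>y. ereal (u y)) \<le> ereal c"
    by (rule Limsup_bounded) (use assms(2) in \<open>simp add: eventually_inf_principal\<close>)
  then show ?thesis using assms(1) by (simp add: Limsup_eq_usc_env)
qed

lemma le_usc_env:
  assumes "z \<in> S" shows "u z \<le> usc_env S u z"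
proof (rule field_le_epsilon)
  fix e :: real assume "e > 0"
  then have "eventually (\<lambda>y. y \<in> S \<longrightarrow> u y < usc_env S u z + e) (nhds z)"
    using assms by (intro usc_env_lessD) auto
  from eventually_nhds_x_imp_x[OF this] assms show "u z \<le> usc_env S u z + e" by simp
qed

lemma usc_on_usc_env: "usc_on S (usc_env S u)"
  unfolding usc_on_def
proof (intro ballI allI impI)
  fix z c assume z: "z \<in> S" "usc_env S u z < c"
  then obtain c' where c': "usc_env S u z < c'" "c' < c" using dense by blast
  obtain N where N: "open N" "z \<in> N" "\<And>y. y \<in> N \<Longrightarrow> y \<in> S \<Longrightarrow> u y < c'"
    using usc_env_lessD[OF z(1) c'(1)] unfolding eventually_nhds by blast
  obtain e where e: "e > 0" "\<And>y. dist y z < e \<Longrightarrow> y \<in> N"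
    using N(1,2) unfolding open_dist by blast
  have "usc_env S u y \<le> c'" if y: "y \<in> S" "dist y z < e" for y
  proof (rule usc_env_le[OF y(1)])
    show "eventually (\<lambda>y. y \<in> S \<longrightarrow> u y \<le> c') (nhds y)"
      unfolding eventually_nhds using N e(2)[OF y(2)] by (meson less_imp_le)
  qed
  with e(1) c'(2) show "\<exists>e>0. \<forall>y\<in>S. dist y z < e \<longrightarrow> usc_env S u y < c"
    by force
qed

lemma usc_env_le_continuous:
  assumes b: "continuous_on UNIV b" "\<And>y. y \<in> S \<Longrightarrow> u y \<le> b y" and z: "z \<in> S"
  shows "usc_env S u z \<le> b z"
proof (rule field_le_epsilon)
  fix e :: real assume e: "e > 0"
  have "isCont b z" using b(1) by (simp add: continuous_on_eq_continuous_at)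
  then have "eventually (\<lambda>y. b y < b z + e) (nhds z)"
    using e unfolding isCont_def tendsto_at_iff_tendsto_nhds
    by (intro order_tendstoD(2)[of b "b z"]) auto
  then show "usc_env S u z \<le> b z + e"
    by (intro usc_env_le[OF z]) (auto elim!: eventually_mono intro: order_trans[OF b(2)])
qed

end

lemma lsc_env_eq: "lsc_env S v z = - usc_env S (\<lambda>y. - v y) z"
  unfolding lsc_env_def usc_env_def
  using ereal_Limsup_uminus[of "inf (nhds z) (principal S)" "\<lambda>y. ereal (v y)"] by simp

lemma locally_bounded_on_minus:
  "locally_bounded_on S v \<Longrightarrow> locally_bounded_on S (\<lambda>y. - v y)"
  unfolding locally_bounded_on_def bounded_iff by simp

section \<open>Separated test functions\<close>

text \<open>
  Every test function of the proof is a function of time plus a function of space. The spatial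
  part lives on a half-line, so its derivative at \<open>0\<close> is one-sided.
\<close>

definition C1_half :: "(real \<Rightarrow> real) \<Rightarrow> (real \<Rightarrow> real) \<Rightarrow> bool" where
  "C1_half g g' \<longleftrightarrow>
     (\<forall>s\<ge>0. (g has_real_derivative g' s) (at s within {0..})) \<and> continuous_on {0..} g'"

definition C1_time :: "real \<Rightarrow> (real \<Rightarrow> real) \<Rightarrow> (real \<Rightarrow> real) \<Rightarrow> bool" where
  "C1_time T a a' \<longleftrightarrow>
     (\<forall>t\<in>{0<..<T}. (a has_real_derivative a' t) (at t)) \<and> continuous_on {0<..<T} a'"

lemma C1_half_minus: "C1_half g g' \<Longrightarrow> C1_half (\<lambda>s. - g s) (\<lambda>s. - g' s)"
  unfolding C1_half_def by (auto intro!: derivative_eq_intros continuous_intros)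

lemma C1_time_minus: "C1_time T a a' \<Longrightarrow> C1_time T (\<lambda>s. - a s) (\<lambda>s. - a' s)"
  unfolding C1_time_def by (auto intro!: derivative_eq_intros continuous_intros)

lemma C1_half_const: "C1_half (\<lambda>s. c) (\<lambda>s. 0)"
  unfolding C1_half_def by (auto intro!: derivative_eq_intros continuous_intros)

text \<open>
  Profiles on the separate branches are put together to a function on the junction. The chosen
  branch is ambiguous only at the vertex, where the profiles are required to agree.
\<close>

definition glue :: "('n::finite \<Rightarrow> real \<Rightarrow> real) \<Rightarrow> 'n junction \<Rightarrow> real" where
  "glue g x = g (SOME i. x \<in> branch i) (radius x)"

lemma glue_jpt:
  assumes "\<And>i j. g i 0 = g j 0" "s \<ge> 0"
  shows "glue g (jpt i s) = g i s"
proof -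
  have "jpt i s \<in> branch (SOME k. jpt i s \<in> branch k)"
    by (rule someI[of _ i]) (use assms(2) in \<open>simp add: jpt_in_branch_iff\<close>)
  then have "i = (SOME k. jpt i s \<in> branch k) \<or> s = 0"
    using assms(2) by (simp add: jpt_in_branch_iff)
  then show ?thesis
    using assms(1)[of "SOME k. jpt i s \<in> branch k" i]
    by (auto simp: glue_def radius_jpt assms(2))
qed

lemma continuous_on_jpt: "continuous_on {0..} (jpt i)"
  unfolding continuous_on_iff by (auto simp: dist_jpt dist_real_def)

lemma dist_zero: "dist 0 x = radius x"
  by (cases x rule: jpt_cases) (metis dist_jpt jpt_zero radius_jpt abs_of_nonneg
      add_0 diff_0 abs_minus_cancel order_refl)

lemma radius_nonneg: "radius x \<ge> 0"
  by (simp add: radius_def)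

lemma continuous_on_radius: "continuous_on A radius"
  unfolding dist_zero[symmetric] by (intro continuous_intros)

lemma closed_branch: "closed (branch i)"
proof -
  have "branch i = {x. dist x (jpt i (radius x)) \<le> 0}"
  proof (intro set_eqI)
    fix x show "x \<in> branch i \<longleftrightarrow> x \<in> {x. dist x (jpt i (radius x)) \<le> 0}"
      by (cases x rule: jpt_cases)
        (auto simp: jpt_in_branch_iff radius_jpt jpt_eq_iff)
  qed
  moreover have "closed {x. dist x (jpt i (radius x)) \<le> 0}"
    by (intro closed_Collect_le continuous_intros continuous_on_compose2[OF continuous_on_jpt]
        continuous_on_radius) (auto simp: radius_nonneg)
  ultimately show ?thesis by simp
qed

lemma continuous_on_glue:
  assumes "\<And>i. continuous_on {0..} (g i)" "\<And>i j. g i 0 = g j 0"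
  shows "continuous_on UNIV (glue g)"
proof -
  have "continuous_on (branch i) (glue g)" for i
  proof -
    have "continuous_on (branch i) (\<lambda>x. g i (radius x))"
      by (rule continuous_on_compose2[OF assms(1) continuous_on_radius]) (auto simp: radius_nonneg)
    moreover have "glue g x = g i (radius x)" if "x \<in> branch i" for x
      using that assms(2) by (auto simp: branch_def glue_jpt radius_jpt)
    ultimately show ?thesis by (simp cong: continuous_on_cong)
  qed
  then have "continuous_on (\<Union>i\<in>UNIV. branch i) (glue g)"
    by (intro continuous_on_closed_Union) (auto simp: closed_branch)
  then show ?thesis by (simp add: Union_branch)
qed

context
  fixes T :: real and a a' and g g' :: "'n::finite \<Rightarrow> real \<Rightarrow> real" and \<phi> :: "real \<times> 'n junction \<Rightarrow> real"
  assumes a: "C1_time T a a'" and g: "\<And>i. C1_half (g i) (g' i)" and g0: "\<And>i j. g i 0 = g j 0"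
  defines "\<phi> \<equiv> \<lambda>(t, x). a t + glue g x"
begin

lemma separated_jpt: "s \<ge> 0 \<Longrightarrow> \<phi> (t, jpt i s) = a t + g i s"
  using g0 by (simp add: \<phi>_def glue_jpt)

lemma separated_test_function: "\<phi> \<in> test_functions T"
proof -
  have ca: "continuous_on {0<..<T} a"
    using a unfolding C1_time_def
    by (meson DERIV_continuous continuous_at_imp_continuous_on)
  have cg: "continuous_on {0..} (g i)" for i
    using g[of i] unfolding C1_half_def
    by (meson DERIV_continuous continuous_on_eq_continuous_within atLeast_iff)
  have "continuous_on ({0<..<T} \<times> UNIV) \<phi>"
    unfolding \<phi>_def case_prod_beta
    by (intro continuous_intros continuous_on_compose2[OF ca]
        continuous_on_compose2[OF continuous_on_glue[OF cg g0]]) auto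
  moreover have "C1_on ({0<..<T} \<times> {0..}) (\<lambda>(t, s). \<phi> (t, jpt i s))" for i
  proof -
    let ?S = "{0<..<T} \<times> {0::real..}"
    define f' :: "real \<times> real \<Rightarrow> (real \<times> real) \<Rightarrow>\<^sub>L real"
      where "f' z = a' (fst z) *\<^sub>R fst_blinfun + g' i (snd z) *\<^sub>R snd_blinfun" for z
    have "continuous_on {0<..<T} a'" "continuous_on {0..} (g' i)"
      using a g[of i] by (simp_all add: C1_time_def C1_half_def)
    then have "continuous_on ?S (\<lambda>z. a' (fst z))" "continuous_on ?S (\<lambda>z. g' i (snd z))"
      by (auto intro!: continuous_on_compose2[OF _ continuous_on_fst]
          continuous_on_compose2[OF _ continuous_on_snd] continuous_on_id)
    then have "continuous_on ?S f'"
      unfolding f'_def by (intro continuous_intros)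
    moreover have "((\<lambda>(t, s). \<phi> (t, jpt i s)) has_derivative blinfun_apply (f' z)) (at z within ?S)"
      if z: "z \<in> ?S" for z
    proof -
      have z': "fst z \<in> {0<..<T}" "snd z \<ge> 0" using z by auto
      then have "(a has_real_derivative a' (fst z)) (at (fst z))"
        using a unfolding C1_time_def by blast
      then have "(a has_derivative (*) (a' (fst z))) (at (fst z) within fst ` ?S)"
        unfolding has_field_derivative_def by (rule has_derivative_at_withinI)
      then have 1: "((\<lambda>z. a (fst z)) has_derivative (\<lambda>h. a' (fst z) * fst h)) (at z within ?S)"
        by (rule has_derivative_in_compose[OF has_derivative_fst[OF has_derivative_ident]])
      have "(g i has_real_derivative g' i (snd z)) (at (snd z) within {0..})"
        using g[of i] z'(2) unfolding C1_half_def by blast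
      then have "(g i has_derivative (*) (g' i (snd z))) (at (snd z) within snd ` ?S)"
        unfolding has_field_derivative_def by (rule has_derivative_subset) auto
      then have 2: "((\<lambda>z. g i (snd z)) has_derivative (\<lambda>h. g' i (snd z) * snd h)) (at z within ?S)"
        by (rule has_derivative_in_compose[OF has_derivative_snd[OF has_derivative_ident]])
      have f'z: "blinfun_apply (f' z) = (\<lambda>h. a' (fst z) * fst h + g' i (snd z) * snd h)"
        by (simp add: f'_def fun_eq_iff blinfun.add_left blinfun.scaleR_left)
      have "((\<lambda>z. a (fst z) + g i (snd z)) has_derivative blinfun_apply (f' z)) (at z within ?S)"
        using has_derivative_add[OF 1 2] unfolding f'z .
      then show ?thesis
        by (rule has_derivative_transform[OF z, rotated]) (auto simp: separated_jpt)
    qed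
    ultimately show ?thesis unfolding C1_on_def by blast
  qed
  ultimately show ?thesis by (simp add: test_functions_def)
qed

lemma time_deriv_separated:
  assumes "0 < t" "t < T"
  shows "time_deriv \<phi> t x = a' t"
  unfolding time_deriv_def \<phi>_def case_prod_conv
  using a assms unfolding C1_time_def
  by (intro DERIV_imp_deriv) (auto intro!: derivative_eq_intros)

lemma branch_deriv_separated:
  assumes "s \<ge> 0"
  shows "branch_deriv i \<phi> t (jpt i s) = g' i s"
proof -
  have "((\<lambda>s. a t + g i s) has_vector_derivative g' i s) (at s within {0..})"
    using g[of i] assms unfolding C1_half_def has_real_derivative_iff_has_vector_derivative[symmetric]
    by (auto intro!: derivative_eq_intros)
  then have "((\<lambda>s. \<phi> (t, jpt i s)) has_vector_derivative g' i s) (at s within {0..})"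
    by (rule has_vector_derivative_transform[rotated 2]) (use assms in \<open>auto simp: separated_jpt\<close>)
  moreover have "at s within {0..} \<noteq> bot"
    using islimpt_subset[of s "{s..s + 1}" "{0..}"] assms
    by (auto simp: trivial_limit_within islimpt_Icc)
  ultimately show ?thesis
    unfolding branch_deriv_def radius_jpt[OF assms] by (intro vector_derivative_within)
qed

end

lemma touches_above_vertexI:
  fixes w :: "real \<times> 'n::finite junction \<Rightarrow> real"
  assumes "e > 0"
    and "\<And>t i s. 0 < t \<Longrightarrow> t < T \<Longrightarrow> \<bar>t - t0\<bar> < e \<Longrightarrow> 0 \<le> s \<Longrightarrow> s < e \<Longrightarrow>
           w (t, jpt i s) - \<phi> (t, jpt i s) \<le> w (t0, 0) - \<phi> (t0, 0)"
  shows "touches_above T \<phi> w (t0, 0)"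
  unfolding touches_above_def eventually_at
proof (intro exI[of _ e] conjI ballI impI)
  fix y :: "real \<times> 'n junction"
  assume y: "y \<in> {0<..<T} \<times> UNIV" "y \<noteq> (t0, 0) \<and> dist y (t0, 0) < e"
  obtain i s where s: "s \<ge> 0" "snd y = jpt i s" by (rule jpt_cases)
  have "\<bar>fst y - t0\<bar> < e" "dist (snd y) 0 < e"
    using y(2) dist_fst_le[of y "(t0, 0)"] dist_snd_le[of y "(t0, 0)"] by (auto simp: dist_real_def)
  moreover have "dist (snd y) 0 = s"
    using s dist_zero[of "snd y"] by (simp add: radius_jpt dist_commute)
  ultimately show "w y - \<phi> y \<le> w (t0, 0) - \<phi> (t0, 0)"
    using assms(2)[of "fst y" s i] y(1) s by (cases y) auto
qed (use assms in auto)

lemma touches_above_branchI: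
  fixes w :: "real \<times> 'n::finite junction \<Rightarrow> real"
  assumes "e > 0" "s0 > 0"
    and "\<And>t s. 0 < t \<Longrightarrow> t < T \<Longrightarrow> \<bar>t - t0\<bar> < e \<Longrightarrow> 0 \<le> s \<Longrightarrow> \<bar>s - s0\<bar> < e \<Longrightarrow>
           w (t, jpt i s) - \<phi> (t, jpt i s) \<le> w (t0, jpt i s0) - \<phi> (t0, jpt i s0)"
  shows "touches_above T \<phi> w (t0, jpt i s0)"
  unfolding touches_above_def eventually_at
proof (intro exI[of _ "min e s0"] conjI ballI impI)
  fix y :: "real \<times> 'n junction"
  assume y: "y \<in> {0<..<T} \<times> UNIV" "y \<noteq> (t0, jpt i s0) \<and> dist y (t0, jpt i s0) < min e s0"
  obtain j s where s: "s \<ge> 0" "snd y = jpt j s" by (rule jpt_cases)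
  have *: "\<bar>fst y - t0\<bar> < e" "dist (jpt j s) (jpt i s0) < min e s0"
    using y(2) dist_fst_le[of y "(t0, jpt i s0)"] dist_snd_le[of y "(t0, jpt i s0)"] s
    by (auto simp: dist_real_def)
  then have "j = i" "\<bar>s - s0\<bar> < e"
    using s assms(2) by (auto simp: dist_jpt split: if_splits)
  then show "w y - \<phi> y \<le> w (t0, jpt i s0) - \<phi> (t0, jpt i s0)"
    using assms(3)[of "fst y" s] y(1) s * by (cases y) auto
qed (use assms in auto)

lemma touches_below_iff:
  "touches_below T \<phi> w z \<longleftrightarrow> touches_above T (\<lambda>y. - \<phi> y) (\<lambda>y. - w y) z"
  unfolding touches_below_def touches_above_def by (simp add: algebra_simps)

section \<open>Branchwise sub-solutions\<close>

text \<open>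
  The viscosity inequalities in branch coordinates: \<open>U i t s\<close> is the value at time \<open>t\<close> and
  distance \<open>s\<close> from the vertex on branch \<open>i\<close>. The test functions are sums \<open>a t + g i s\<close>. A test at
  an interior point of a branch involves that branch alone, because a small ball around the point
  does not reach the vertex.
\<close>

locale junction_subsolution =
  fixes T :: real and H :: "'n::finite \<Rightarrow> real \<Rightarrow> real" and F :: "('n \<Rightarrow> real) \<Rightarrow> real"
    and U :: "'n \<Rightarrow> real \<Rightarrow> real \<Rightarrow> real"
  assumes usc: "usc_on ({0..<T} \<times> {0..}) (\<lambda>z. U i (fst z) (snd z))"
    and vertex_eq: "U i t 0 = U j t 0"
    and vertex_test: "C1_time T a a' \<Longrightarrow> (\<And>i. C1_half (g i) (g' i)) \<Longrightarrow> (\<And>i j. g i 0 = g j 0) \<Longrightarrow>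
      0 < t0 \<Longrightarrow> t0 < T \<Longrightarrow> e > 0 \<Longrightarrow>
      (\<And>t i s. 0 < t \<Longrightarrow> t < T \<Longrightarrow> \<bar>t - t0\<bar> < e \<Longrightarrow> 0 \<le> s \<Longrightarrow> s < e \<Longrightarrow>
         U i t s - (a t + g i s) \<le> U k t0 0 - (a t0 + g k 0)) \<Longrightarrow>
      a' t0 + F (\<lambda>i. g' i 0) \<le> 0 \<or> (\<exists>i. a' t0 + H i (g' i 0) \<le> 0)"
    and branch_test: "C1_time T a a' \<Longrightarrow> C1_half h h' \<Longrightarrow> 0 < t0 \<Longrightarrow> t0 < T \<Longrightarrow> 0 < s0 \<Longrightarrow> e > 0 \<Longrightarrow>
      (\<And>t s. 0 < t \<Longrightarrow> t < T \<Longrightarrow> \<bar>t - t0\<bar> < e \<Longrightarrow> 0 \<le> s \<Longrightarrow> \<bar>s - s0\<bar> < e \<Longrightarrow>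
         U i t s - (a t + h s) \<le> U i t0 s0 - (a t0 + h s0)) \<Longrightarrow>
      a' t0 + H i (h' s0) \<le> 0"

lemma usc_on_jpt:
  assumes "usc_on (S \<times> UNIV) w"
  shows "usc_on (S \<times> {0..}) (\<lambda>z. w (fst z, jpt i (snd z)))"
  by (rule usc_on_compose[OF assms])
    (auto intro!: continuous_intros continuous_on_compose2[OF continuous_on_jpt])

lemma relaxed_subsolution_imp_junction_subsolution:
  fixes H :: "'n::finite \<Rightarrow> real \<Rightarrow> real"
  assumes u: "relaxed_subsolution T H F u"
  shows "junction_subsolution T H F (\<lambda>i t s. usc_env ({0..<T} \<times> UNIV) u (t, jpt i s))"
proof
  let ?U = "usc_env ({0..<T} \<times> UNIV) u"
  have lb: "locally_bounded_on ({0..<T} \<times> UNIV) u" using u by (simp add: relaxed_subsolution_def)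
  have test: "(\<forall>i. x \<in> open_branch i \<longrightarrow> time_deriv \<phi> t x + H i (branch_deriv i \<phi> t x) \<le> 0) \<and>
          (x = 0 \<longrightarrow>
             time_deriv \<phi> t 0 + F (\<lambda>i. branch_deriv i \<phi> t 0) \<le> 0 \<or>
             (\<exists>i. time_deriv \<phi> t 0 + H i (branch_deriv i \<phi> t 0) \<le> 0))"
    if "\<phi> \<in> test_functions T" "0 < t" "t < T" "touches_above T \<phi> ?U (t, x)" for \<phi> t x
    using u that unfolding relaxed_subsolution_def by auto
  show "usc_on ({0..<T} \<times> {0..}) (\<lambda>z. ?U (fst z, jpt i (snd z)))" for i
    by (rule usc_on_jpt[OF usc_on_usc_env[OF lb]])
  show "?U (t, jpt i 0) = ?U (t, jpt j 0)" for i j t by (simp add: jpt_zero)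
  {
    fix a a' t0 e k and g g' :: "'n \<Rightarrow> real \<Rightarrow> real"
    assume a: "C1_time T a a'" and g: "\<And>i. C1_half (g i) (g' i)" "\<And>i j. g i 0 = g j 0"
      and t0: "0 < t0" "t0 < T" and e: "e > 0" "\<And>t i s. 0 < t \<Longrightarrow> t < T \<Longrightarrow> \<bar>t - t0\<bar> < e \<Longrightarrow>
        0 \<le> s \<Longrightarrow> s < e \<Longrightarrow> ?U (t, jpt i s) - (a t + g i s) \<le> ?U (t0, jpt k 0) - (a t0 + g k 0)"
    let ?\<phi> = "\<lambda>(t, x). a t + glue g x"
    have glue: "glue g (jpt i s) = g i s" if "s \<ge> 0" for i s
      by (rule glue_jpt[OF _ that]) (use g(2) in blast)
    have "touches_above T ?\<phi> ?U (t0, 0)"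
      using e glue[of 0 k]
      by (intro touches_above_vertexI[OF e(1)]) (auto simp: glue jpt_zero)
    from test[OF separated_test_function[where g = g and g' = g', OF a g] t0 this]
    have "time_deriv ?\<phi> t0 0 + F (\<lambda>i. branch_deriv i ?\<phi> t0 0) \<le> 0 \<or>
             (\<exists>i. time_deriv ?\<phi> t0 0 + H i (branch_deriv i ?\<phi> t0 0) \<le> 0)" by blast
    then show "a' t0 + F (\<lambda>i. g' i 0) \<le> 0 \<or> (\<exists>i. a' t0 + H i (g' i 0) \<le> 0)"
      using branch_deriv_separated[where g = g and g' = g', OF a g, where s = 0 and t = t0] time_deriv_separated[where g = g and g' = g', OF a g t0]
      by (simp add: jpt_zero)
  next
    fix a a' t0 s0 e i and h h' :: "real \<Rightarrow> real"
    assume a: "C1_time T a a'" and h: "C1_half h h'"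
      and t0: "0 < t0" "t0 < T" "0 < s0" and e: "e > 0" "\<And>t s. 0 < t \<Longrightarrow> t < T \<Longrightarrow>
        \<bar>t - t0\<bar> < e \<Longrightarrow> 0 \<le> s \<Longrightarrow> \<bar>s - s0\<bar> < e \<Longrightarrow>
        ?U (t, jpt i s) - (a t + h s) \<le> ?U (t0, jpt i s0) - (a t0 + h s0)"
    define g where "g j = (if j = i then h else (\<lambda>_. h 0))" for j
    define g' where "g' j = (if j = i then h' else (\<lambda>_. 0))" for j
    have g: "\<And>j. C1_half (g j) (g' j)" "\<And>j k. g j 0 = g k 0"
      using h by (auto simp: g_def g'_def C1_half_const)
    let ?\<phi> = "\<lambda>(t, x). a t + glue g x"
    have glue: "glue g (jpt i s) = g i s" if "s \<ge> 0" for i s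
      by (rule glue_jpt[OF _ that]) (use g(2) in blast)
    have "touches_above T ?\<phi> ?U (t0, jpt i s0)"
      using e t0 by (intro touches_above_branchI[OF e(1)]) (auto simp: glue g_def)
    moreover have "jpt i s0 \<in> open_branch i"
      using t0 by (simp add: open_branch_def jpt_in_branch_iff jpt_eq_0_iff)
    ultimately have "time_deriv ?\<phi> t0 (jpt i s0) + H i (branch_deriv i ?\<phi> t0 (jpt i s0)) \<le> 0"
      using test[OF separated_test_function[where g = g and g' = g', OF a g] t0(1,2)] by blast
    then show "a' t0 + H i (h' s0) \<le> 0"
      using branch_deriv_separated[where g = g and g' = g', OF a g, where s = s0 and i = i and t = t0] time_deriv_separated[where g = g and g' = g', OF a g t0(1,2)] t0
      by (simp add: g'_def)
  }
qed

text \<open>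
  If \<open>v\<close> is a super-solution for \<open>H\<close> and \<open>F\<close>, then \<open>- v\<close> is a sub-solution for \<open>\<lambda>p. - H (- p)\<close> and
  \<open>\<lambda>p. - F (- p)\<close>: minima become maxima and test functions change sign. Then both unknowns are
  upper semicontinuous, and results about sub-solutions apply to both. The dual Hamiltonians tend
  to \<open>- \<infinity>\<close>, which is why coercivity is an assumption of single lemmas and not of the locale.
\<close>

lemma relaxed_supersolution_imp_junction_subsolution:
  fixes H :: "'n::finite \<Rightarrow> real \<Rightarrow> real"
  assumes v: "relaxed_supersolution T H F v"
  shows "junction_subsolution T (\<lambda>i p. - H i (- p)) (\<lambda>p. - F (\<lambda>i. - p i))
           (\<lambda>i t s. - lsc_env ({0..<T} \<times> UNIV) v (t, jpt i s))"
proof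
  let ?V = "lsc_env ({0..<T} \<times> UNIV) v"
  have lb: "locally_bounded_on ({0..<T} \<times> UNIV) v" using v by (simp add: relaxed_supersolution_def)
  have test: "(\<forall>i. x \<in> open_branch i \<longrightarrow> time_deriv \<phi> t x + H i (branch_deriv i \<phi> t x) \<ge> 0) \<and>
          (x = 0 \<longrightarrow>
             time_deriv \<phi> t 0 + F (\<lambda>i. branch_deriv i \<phi> t 0) \<ge> 0 \<or>
             (\<exists>i. time_deriv \<phi> t 0 + H i (branch_deriv i \<phi> t 0) \<ge> 0))"
    if "\<phi> \<in> test_functions T" "0 < t" "t < T" "touches_below T \<phi> ?V (t, x)" for \<phi> t x
    using v that unfolding relaxed_supersolution_def by auto
  show "usc_on ({0..<T} \<times> {0..}) (\<lambda>z. - ?V (fst z, jpt i (snd z)))" for i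
    using usc_on_jpt[OF usc_on_usc_env[OF locally_bounded_on_minus[OF lb]]]
    by (simp add: lsc_env_eq)
  show "- ?V (t, jpt i 0) = - ?V (t, jpt j 0)" for i j t by (simp add: jpt_zero)
  {
    fix a a' t0 e k and g g' :: "'n \<Rightarrow> real \<Rightarrow> real"
    assume a: "C1_time T a a'" and g: "\<And>i. C1_half (g i) (g' i)" "\<And>i j. g i 0 = g j 0"
      and t0: "0 < t0" "t0 < T" and e: "e > 0" "\<And>t i s. 0 < t \<Longrightarrow> t < T \<Longrightarrow> \<bar>t - t0\<bar> < e \<Longrightarrow>
        0 \<le> s \<Longrightarrow> s < e \<Longrightarrow> - ?V (t, jpt i s) - (a t + g i s) \<le> - ?V (t0, jpt k 0) - (a t0 + g k 0)"
    let ?h = "\<lambda>i s. - g i s" and ?h' = "\<lambda>i s. - g' i s"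
    let ?\<phi> = "\<lambda>(t, x). - a t + glue ?h x"
    note a' = C1_time_minus[OF a]
    have h: "\<And>i. C1_half (?h i) (?h' i)" "\<And>i j. ?h i 0 = ?h j 0"
      using g by (auto intro: C1_half_minus)
    have glue: "glue ?h (jpt i s) = ?h i s" if "s \<ge> 0" for i s
      by (rule glue_jpt[OF _ that]) (use h(2) in blast)
    have "touches_below T ?\<phi> ?V (t0, 0)"
      unfolding touches_below_iff using e glue[of 0 k]
      by (intro touches_above_vertexI[OF e(1)]) (auto simp: glue jpt_zero)
    from test[OF separated_test_function[where g = ?h and g' = ?h', OF a' h] t0 this]
    have "time_deriv ?\<phi> t0 0 + F (\<lambda>i. branch_deriv i ?\<phi> t0 0) \<ge> 0 \<or>
             (\<exists>i. time_deriv ?\<phi> t0 0 + H i (branch_deriv i ?\<phi> t0 0) \<ge> 0)" by blast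
    then show "a' t0 + - F (\<lambda>i. - g' i 0) \<le> 0 \<or> (\<exists>i. a' t0 + - H i (- g' i 0) \<le> 0)"
      using branch_deriv_separated[where g = ?h and g' = ?h', OF a' h, where s = 0 and t = t0] time_deriv_separated[where g = ?h and g' = ?h', OF a' h t0]
      by (simp add: jpt_zero)
  next
    fix a a' t0 s0 e i and h h' :: "real \<Rightarrow> real"
    assume a: "C1_time T a a'" and h: "C1_half h h'"
      and t0: "0 < t0" "t0 < T" "0 < s0" and e: "e > 0" "\<And>t s. 0 < t \<Longrightarrow> t < T \<Longrightarrow>
        \<bar>t - t0\<bar> < e \<Longrightarrow> 0 \<le> s \<Longrightarrow> \<bar>s - s0\<bar> < e \<Longrightarrow>
        - ?V (t, jpt i s) - (a t + h s) \<le> - ?V (t0, jpt i s0) - (a t0 + h s0)"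
    define g where "g j = (if j = i then (\<lambda>s. - h s) else (\<lambda>_. - h 0))" for j
    define g' where "g' j = (if j = i then (\<lambda>s. - h' s) else (\<lambda>_. 0))" for j
    note a' = C1_time_minus[OF a]
    have g: "\<And>j. C1_half (g j) (g' j)" "\<And>j k. g j 0 = g k 0"
      using h by (auto simp: g_def g'_def C1_half_const C1_half_minus)
    let ?\<phi> = "\<lambda>(t, x). - a t + glue g x"
    have glue: "glue g (jpt i s) = g i s" if "s \<ge> 0" for i s
      by (rule glue_jpt[OF _ that]) (use g(2) in blast)
    have "touches_below T ?\<phi> ?V (t0, jpt i s0)"
      unfolding touches_below_iff
      using e t0 by (intro touches_above_branchI[OF e(1)]) (auto simp: glue g_def)
    moreover have "jpt i s0 \<in> open_branch i"
      using t0 by (simp add: open_branch_def jpt_in_branch_iff jpt_eq_0_iff)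
    ultimately have "time_deriv ?\<phi> t0 (jpt i s0) + H i (branch_deriv i ?\<phi> t0 (jpt i s0)) \<ge> 0"
      using test[OF separated_test_function[where g = g and g' = g', OF a' g] t0(1,2)] by blast
    then show "a' t0 + - H i (- h' s0) \<le> 0"
      using branch_deriv_separated[where g = g and g' = g', OF a' g, where s = s0 and i = i and t = t0] time_deriv_separated[where g = g and g' = g', OF a' g t0(1,2)] t0
      by (simp add: g'_def)
  }
qed

section \<open>Test functions and barriers\<close>

lemma C1_half_quadratic: "C1_half (\<lambda>s. A * s\<^sup>2 + B * s + C) (\<lambda>s. 2 * A * s + B)"
  unfolding C1_half_def by (auto intro!: derivative_eq_intros continuous_intros)

lemma C1_half_sqrt:
  assumes "\<delta> > 0"
  shows "C1_half (\<lambda>s. L * sqrt (\<delta>\<^sup>2 + (s + c)\<^sup>2)) (\<lambda>s. L * ((s + c) / sqrt (\<delta>\<^sup>2 + (s + c)\<^sup>2)))"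
proof -
  have pos: "\<delta>\<^sup>2 + (s + c)\<^sup>2 > 0" for s using assms by (simp add: add_pos_nonneg)
  have ne: "\<delta>\<^sup>2 + (s + c)\<^sup>2 \<noteq> 0" for s by (rule less_imp_neq[OF pos, THEN not_sym])
  have "((\<lambda>s. L * sqrt (\<delta>\<^sup>2 + (s + c)\<^sup>2)) has_real_derivative
          L * ((s + c) / sqrt (\<delta>\<^sup>2 + (s + c)\<^sup>2))) (at s within {0..})" for s
  proof -
    have "((\<lambda>s. \<delta>\<^sup>2 + (s + c)\<^sup>2) has_real_derivative 2 * (s + c)) (at s within {0..})"
      by (auto intro!: derivative_eq_intros)
    from DERIV_cmult[OF DERIV_chain2[OF DERIV_real_sqrt[OF pos] this], of L]
    have "((\<lambda>s. L * sqrt (\<delta>\<^sup>2 + (s + c)\<^sup>2)) has_real_derivative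
        L * (inverse (sqrt (\<delta>\<^sup>2 + (s + c)\<^sup>2)) / 2 * (2 * (s + c)))) (at s within {0..})" .
    moreover have "inverse x / 2 * (2 * y) = y / x" for x y :: real
      by (cases "x = 0") (simp_all add: field_simps)
    ultimately show ?thesis by (simp only:)
  qed
  moreover have "continuous_on {0..} (\<lambda>s. L * ((s + c) / sqrt (\<delta>\<^sup>2 + (s + c)\<^sup>2)))"
    by (intro continuous_intros ballI real_sqrt_gt_zero[OF pos, THEN less_imp_neq, THEN not_sym])
  ultimately show ?thesis unfolding C1_half_def by blast
qed

text \<open>
  The term \<open>\<eta> / (T - t)\<close> keeps maximum points away from the final time, and its positive
  derivative turns the viscosity inequalities into strict ones.
\<close>

lemma C1_time_penalty:
  "C1_time T (\<lambda>t. \<eta> / (T - t) + B * (t - c) + A * (t - c)\<^sup>2)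
     (\<lambda>t. \<eta> / (T - t)\<^sup>2 + B + 2 * A * (t - c))"
proof -
  have "((\<lambda>t. \<eta> / (T - t) + B * (t - c) + A * (t - c)\<^sup>2) has_real_derivative
         \<eta> / (T - t)\<^sup>2 + B + 2 * A * (t - c)) (at t)" if "t < T" for t
    using that by (auto intro!: derivative_eq_intros simp: power2_eq_square)
  moreover have "continuous_on {0<..<T} (\<lambda>t. \<eta> / (T - t)\<^sup>2 + B + 2 * A * (t - c))"
    by (intro continuous_intros) auto
  ultimately show ?thesis unfolding C1_time_def by auto
qed

context junction_subsolution
begin

text \<open>
  If \<open>- K\<close> bounds \<open>H\<close> and \<open>F\<close> from below for slopes up to \<open>L\<close>, a cone of slope \<open>L\<close> that rises
  faster than \<open>K\<close> violates the sub-solution inequalities and hence cannot touch a sub-solution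
  from above. The cone \<open>L \<cdot> d(x, y)\<close> around the point \<open>y\<close> at distance \<open>b\<close> on branch \<open>i\<close> has a kink
  at \<open>y\<close> and is replaced by \<open>L * sqrt (\<delta>\<^sup>2 + d(x, y)\<^sup>2)\<close>, which is smooth with slopes still at
  most \<open>L\<close>. As \<open>L\<close> exceeds the growth rate \<open>C\<close>, the maximum of the difference is attained.
\<close>

lemma barrier:
  assumes C: "0 \<le> C" "C < L" and K: "0 \<le> K" "\<And>p. (\<And>j. \<bar>p j\<bar> \<le> L) \<Longrightarrow> - K \<le> F p"
      "\<And>j p. \<bar>p\<bar> \<le> L \<Longrightarrow> - K \<le> H j p"
    and growth: "\<And>j t s. 0 \<le> t \<Longrightarrow> t < T \<Longrightarrow> 0 \<le> s \<Longrightarrow> U j t s \<le> C * (1 + s)"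
    and initial: "\<And>j s. 0 \<le> s \<Longrightarrow> U j 0 s \<le> w + L * \<bar>s + (if j = i then - b else b)\<bar>"
    and b: "0 \<le> b" and t1: "0 \<le> t1" "t1 < T"
  shows "U i t1 b \<le> w + K * t1"
proof (rule ccontr)
  assume "\<not> U i t1 b \<le> w + K * t1"
  define \<mu> where "\<mu> = (U i t1 b - w - K * t1) / 3"
  have \<mu>: "\<mu> > 0" "U i t1 b = w + K * t1 + 3 * \<mu>"
    using \<open>\<not> U i t1 b \<le> w + K * t1\<close> by (simp_all add: \<mu>_def field_simps)
  have L: "L > 0" using C by simp
  define \<delta> \<eta> where "\<delta> = \<mu> / L" and "\<eta> = \<mu> * (T - t1)"
  have \<delta>: "\<delta> > 0" and \<eta>: "\<eta> > 0" using \<mu> L t1 by (auto simp: \<delta>_def \<eta>_def)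
  \<comment> \<open>On each branch the distance to the centre of the cone is \<open>\<bar>s + c j\<bar>\<close>.\<close>
  define c where "c j = (if j = i then - b else b)" for j
  define D where "D j s = sqrt (\<delta>\<^sup>2 + (s + c j)\<^sup>2)" for j s
  have D: "\<bar>s + c j\<bar> \<le> D j s" for j s
    unfolding D_def by (rule real_le_rsqrt) simp
  define a where "a t = \<eta> / (T - t) + K * (t - 0) + 0 * (t - 0)\<^sup>2" for t
  define \<Psi> where "\<Psi> j z = U j (fst z) (snd z) - (a (fst z) + L * D j (snd z))" for j z
  \<comment> \<open>Outside the box given by \<open>R\<close> and \<open>\<kappa>\<close>, either \<open>(L - C) * s\<close> or \<open>\<eta> / (T - t)\<close> alone exceeds
    \<open>M\<close>, and then \<open>\<Psi> < w\<close>.\<close>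
  define M where "M = C + L * b + \<bar>w\<bar> + 1"
  have M: "M > 0" using C L b by (simp add: M_def add_nonneg_pos)
  define R where "R = b + M / (L - C)"
  define \<kappa> where "\<kappa> = min (T - t1) (\<eta> / M)"
  have \<kappa>: "\<kappa> > 0" using t1 \<eta> M by (simp add: \<kappa>_def)
  have \<Psi>1: "\<Psi> i (t1, b) = w + \<mu>"
  proof -
    have "D i b = \<delta>" using \<delta> by (simp add: D_def c_def)
    moreover have "\<eta> / (T - t1) = \<mu>" using t1 by (simp add: \<eta>_def)
    ultimately show ?thesis using \<mu>(2) L by (simp add: \<Psi>_def a_def \<delta>_def)
  qed
  have "\<exists>j. \<exists>z\<in>{0..T - \<kappa>} \<times> {0..R}. \<forall>k. \<forall>y\<in>{0..<T} \<times> {0..}. \<Psi> k y \<le> \<Psi> j z"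
  proof (rule usc_family_attains_max_superlevel)
    show "usc_on ({0..<T} \<times> {0..}) (\<Psi> j)" for j
      unfolding \<Psi>_def a_def D_def
      by (intro usc_on_diff_continuous usc continuous_intros) auto
    show "compact ({0..T - \<kappa>} \<times> {0..R})" by (intro compact_Times compact_Icc)
    show "(t1, b) \<in> {0..T - \<kappa>} \<times> {0..R}"
      using t1 b M C by (auto simp: \<kappa>_def R_def)
    then show "{0..T - \<kappa>} \<times> {0..R} \<noteq> {}" by blast
    show "{0..T - \<kappa>} \<times> {0..R} \<subseteq> {0..<T} \<times> {0..}" using \<kappa> by auto
    fix j and y :: "real \<times> real"
    assume y: "y \<in> {0..<T} \<times> {0..}" "y \<notin> {0..T - \<kappa>} \<times> {0..R}"
    obtain t s where ts: "y = (t, s)" by (cases y)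
    have t: "0 \<le> t" "t < T" "0 \<le> s" using y ts by auto
    have "L * (s - b) \<le> L * D j s"
      using D[of s j] L b by (intro mult_left_mono) (auto simp: c_def split: if_splits)
    then have le: "\<Psi> j y \<le> C + L * b - (L - C) * s - \<eta> / (T - t)"
      using growth[OF t, of j] K t by (simp add: \<Psi>_def ts a_def algebra_simps)
        (smt (verit) mult_nonneg_nonneg)
    have pos: "\<eta> / (T - t) \<ge> 0" "(L - C) * s \<ge> 0" using \<eta> t C by auto
    have "(L - C) * s > M \<or> \<eta> / (T - t) > M"
    proof (cases "s > R")
      case True
      then have "s > M / (L - C)" using b by (simp add: R_def)
      then show ?thesis using C by (simp add: pos_divide_less_eq mult.commute)
    next
      case False
      then have "T - t < \<eta> / M" using y t ts by (auto simp: \<kappa>_def)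
      then show ?thesis using t M by (simp add: field_simps)
    qed
    then show "\<Psi> j y \<le> \<Psi> i (t1, b)"
      using le pos \<Psi>1 \<mu>(1) by (auto simp: M_def)
  qed
  then obtain j z where z: "z \<in> {0..T - \<kappa>} \<times> {0..R}"
    and maxz: "\<And>k y. y \<in> {0..<T} \<times> {0..} \<Longrightarrow> \<Psi> k y \<le> \<Psi> j z" by blast
  obtain r s where rs: "r \<in> {0..T - \<kappa>}" "s \<in> {0..R}" "z = (r, s)" using z by blast
  note max = maxz[unfolded rs(3)]
  have r: "0 \<le> r" "r < T" "0 \<le> s" using rs \<kappa> by auto
  have big: "w + \<mu> \<le> \<Psi> j (r, s)" using max[of "(t1, b)" i] \<Psi>1 t1 b by simp
  have "r \<noteq> 0"
  proof
    assume "r = 0"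
    have "L * \<bar>s + c j\<bar> \<le> L * D j s" using D[of s j] L by simp
    moreover have "\<eta> / T > 0" using \<eta> r by auto
    ultimately show False
      using initial[OF r(3), of j] big \<mu>(1) \<open>r = 0\<close> by (simp add: \<Psi>_def a_def c_def)
  qed
  then have r0: "0 < r" using r by simp
  define a' where "a' t = \<eta> / (T - t)\<^sup>2 + K + 2 * 0 * (t - 0)" for t
  define D' where "D' j s = L * ((s + c j) / sqrt (\<delta>\<^sup>2 + (s + c j)\<^sup>2))" for j s
  have a: "C1_time T a a'" unfolding a_def a'_def by (rule C1_time_penalty)
  have g: "C1_half (\<lambda>s. L * D j s) (D' j)" for j
    unfolding D_def D'_def by (rule C1_half_sqrt[OF \<delta>])
  have "D j 0 = D k 0" for j k by (auto simp: D_def c_def)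
  then have g0: "L * D j 0 = L * D k 0" for j k by metis
  have a'r: "a' r > K" using \<eta> r by (simp add: a'_def)
  have slope: "\<bar>D' j s\<bar> \<le> L" for j s
  proof -
    have "D j s > 0" using \<delta> by (simp add: D_def add_pos_nonneg)
    then have "\<bar>(s + c j) / D j s\<bar> \<le> 1" using D[of s j] by (simp add: abs_divide)
    then show ?thesis
      using L mult_left_mono[of "\<bar>(s + c j) / D j s\<bar>" 1 L]
      unfolding D'_def D_def by (simp add: abs_mult)
  qed
  have max': "U k t x - (a t + L * D k x) \<le> U j r s - (a r + L * D j s)"
    if "0 < t" "t < T" "0 \<le> x" for k t x
    using max[of "(t, x)" k] that by (simp add: \<Psi>_def)
  show False
  proof (cases "s = 0")
    case True
    have "a' r + F (\<lambda>i. D' i 0) \<le> 0 \<or> (\<exists>i. a' r + H i (D' i 0) \<le> 0)"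
      by (rule vertex_test[where g = "\<lambda>i s. L * D i s" and g' = D' and k = j,
            OF a g g0 r0 r(2) zero_less_one]) (use max' True in auto)
    moreover have "- K \<le> F (\<lambda>i. D' i 0)" by (rule K(2)) (rule slope)
    moreover have "- K \<le> H i (D' i 0)" for i by (rule K(3)) (rule slope)
    ultimately show False using a'r by (smt (verit))
  next
    case False
    then have "a' r + H j (D' j s) \<le> 0"
      using r by (intro branch_test[OF a g[of j] r0 r(2) _ zero_less_one]) (use max' in auto)
    moreover have "- K \<le> H j (D' j s)" by (rule K(3)) (rule slope)
    ultimately show False using a'r by simp
  qed
qed

end

section \<open>Uniformly continuous functions on the junction\<close>

text \<open>
  The points \<open>a\<close> and \<open>b\<close> are joined by a chain of steps of length at most \<open>\<delta> / 2\<close>, whose number is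
  bounded by a linear function of their distance.
\<close>

lemma uniform_modulus_imp_linear_bound:
  fixes f :: "real \<Rightarrow> real"
  assumes f: "\<And>a b. 0 \<le> a \<Longrightarrow> 0 \<le> b \<Longrightarrow> \<bar>a - b\<bar> < \<delta> \<Longrightarrow> \<bar>f a - f b\<bar> \<le> \<theta>"
    and pos: "\<delta> > 0" "\<theta> \<ge> 0" and ab: "0 \<le> a" "0 \<le> b"
  shows "\<bar>f a - f b\<bar> \<le> \<theta> + 2 * \<theta> / \<delta> * \<bar>a - b\<bar>"
proof -
  have chain: "\<bar>a - b\<bar> \<le> real n * (\<delta> / 2) \<Longrightarrow> \<bar>f a - f b\<bar> \<le> real n * \<theta>" if "0 \<le> a" for n a
    using that
  proof (induction n arbitrary: a)
    case 0
    then show ?case by simp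
  next
    case (Suc n)
    define d where "d = (a - b) / real (Suc n)"
    have d: "a - b = real (Suc n) * d" by (simp add: d_def)
    have "real (Suc n) * \<bar>d\<bar> \<le> real (Suc n) * (\<delta> / 2)"
      using Suc.prems(1) unfolding d by (simp add: abs_mult)
    then have dd: "\<bar>d\<bar> \<le> \<delta> / 2" by (simp only: mult_le_cancel_left_pos of_nat_0_less_iff zero_less_Suc)
    define e where "e = b + real n * d"
    have e: "a = e + d" using d by (simp add: e_def algebra_simps)
    have "e \<ge> 0"
    proof (cases "d \<ge> 0")
      case True
      then show ?thesis using ab by (simp add: e_def)
    next
      case False
      then show ?thesis using e Suc.prems(2) by simp
    qed
    have "\<bar>e - b\<bar> \<le> real n * (\<delta> / 2)"
      using mult_left_mono[OF dd, of "real n"] by (simp add: e_def abs_mult)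
    then have "\<bar>f e - f b\<bar> \<le> real n * \<theta>" using \<open>e \<ge> 0\<close> by (rule Suc.IH)
    moreover have "\<bar>f a - f e\<bar> \<le> \<theta>"
      using f[OF Suc.prems(2) \<open>e \<ge> 0\<close>] e dd pos by simp
    ultimately show ?case by (simp add: algebra_simps)
  qed
  define n where "n = nat \<lceil>2 * \<bar>a - b\<bar> / \<delta>\<rceil>"
  have n: "2 * \<bar>a - b\<bar> / \<delta> \<le> real n" "real n \<le> 2 * \<bar>a - b\<bar> / \<delta> + 1"
    unfolding n_def using pos by (simp_all add: of_nat_nat)
  have "\<bar>a - b\<bar> \<le> real n * (\<delta> / 2)" using n(1) pos by (simp add: field_simps)
  then have "\<bar>f a - f b\<bar> \<le> real n * \<theta>" by (rule chain[OF ab(1)])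
  also have "\<dots> \<le> (2 * \<bar>a - b\<bar> / \<delta> + 1) * \<theta>" using n(2) pos by (intro mult_right_mono) auto
  finally show ?thesis by (simp add: algebra_simps)
qed

text \<open>
  The slope \<open>L\<close> depends on \<open>\<theta>\<close> but not on the points. The barriers for both solutions therefore
  have a speed that is uniform on the whole junction.
\<close>

lemma uniformly_continuous_junction_modulus:
  fixes u0 :: "'n::finite junction \<Rightarrow> real"
  assumes u0: "uniformly_continuous_on UNIV u0" and \<theta>: "\<theta> > 0"
  obtains L where "L > 0" "\<And>x y. u0 x - u0 y \<le> \<theta> + L * dist x y"
proof -
  obtain \<delta> where \<delta>: "\<delta> > 0" "\<And>x y. dist x y < \<delta> \<Longrightarrow> dist (u0 x) (u0 y) < \<theta> / 2"
    using u0 \<theta> unfolding uniformly_continuous_on_def by (metis UNIV_I half_gt_zero)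
  define L where "L = \<theta> / \<delta>"
  have same: "\<bar>u0 (jpt i a) - u0 (jpt i b)\<bar> \<le> \<theta> / 2 + L * \<bar>a - b\<bar>"
    if "a \<ge> 0" "b \<ge> 0" for i a b
    using uniform_modulus_imp_linear_bound[of \<delta> "\<lambda>a. u0 (jpt i a)" "\<theta> / 2" a b] \<delta> \<theta> that
    by (simp add: dist_jpt dist_real_def less_imp_le L_def)
  have "u0 x - u0 y \<le> \<theta> + L * dist x y" for x y
  proof -
    obtain i a where x: "a \<ge> 0" "x = jpt i a" by (rule jpt_cases)
    obtain j b where y: "b \<ge> 0" "y = jpt j b" by (rule jpt_cases)
    show ?thesis
    proof (cases "i = j")
      case True
      then show ?thesis using same[OF x(1) y(1), of i] x y \<theta> by (simp add: dist_jpt)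
    next
      case False
      then show ?thesis
        using same[OF x(1), of 0 i] same[OF y(1), of 0 j] x y
        by (simp add: dist_jpt jpt_zero algebra_simps)
    qed
  qed
  moreover have "L > 0" using \<delta> \<theta> by (simp add: L_def)
  ultimately show ?thesis using that by blast
qed

section \<open>One-sided slopes at the vertex\<close>

lemma C1_half_linear: "C1_half (\<lambda>s. p * s) (\<lambda>s. p)"
  using C1_half_quadratic[of 0 p 0] by simp

lemma coercive_bound:
  assumes "coercive h"
  shows "\<exists>R. \<forall>p. R \<le> \<bar>p\<bar> \<longrightarrow> B < h p"
proof -
  have "eventually (\<lambda>p. B < h p) at_infinity"
    using assms unfolding coercive_def filterlim_at_top_dense by blast
  then show ?thesis by (auto simp: eventually_at_infinity)
qed

lemma C1_time_continuous:
  assumes "C1_time T a a'" shows "continuous_on {0<..<T} a"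
  using assms unfolding C1_time_def by (meson DERIV_continuous continuous_at_imp_continuous_on)

context junction_subsolution
begin

text \<open>
  Let \<open>a\<close> touch the sub-solution from above, in time only, at the vertex and strictly at \<open>r0\<close>. The
  difference \<open>f\<close> is then a function on which only spatial slopes have to be tested, and any
  maximum of \<open>f\<close> minus a small perturbation is attained at a time near \<open>r0\<close>. All branches
  share the value at the vertex, so the index \<open>undefined\<close> stands for an arbitrary branch.
\<close>

context
  fixes a a' :: "real \<Rightarrow> real" and r0 \<rho> f0 :: real and f :: "'n \<Rightarrow> real \<Rightarrow> real \<Rightarrow> real"
  assumes a: "C1_time T a a'" and \<rho>: "\<rho> > 0" "0 < r0 - \<rho>" "r0 + \<rho> < T"
  defines "f \<equiv> \<lambda>j r s. U j r s - a r" and "f0 \<equiv> U undefined r0 0 - a r0"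
  assumes strict: "\<And>j r. \<bar>r - r0\<bar> \<le> \<rho> \<Longrightarrow> r \<noteq> r0 \<Longrightarrow> f j r 0 < f0"
begin

lemma f_r0: "f j r0 0 = f0"
  unfolding f_def f0_def using vertex_eq[of j r0 undefined] by simp

lemma f_vertex_eq: "f i r 0 = f j r 0"
  unfolding f_def using vertex_eq[of i r j] by simp

lemma f_vertex_le: "\<bar>r - r0\<bar> \<le> \<rho> \<Longrightarrow> f j r 0 \<le> f0"
  using strict[of r j] f_r0[of j] by (cases "r = r0") auto

lemma usc_f: "usc_on ({r0 - \<rho>..r0 + \<rho>} \<times> {0..}) (\<lambda>z. f j (fst z) (snd z))"
proof -
  have "continuous_on ({r0 - \<rho>..r0 + \<rho>} \<times> {0::real..}) (\<lambda>z. a (fst z))"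
    using \<rho> by (intro continuous_on_compose2[OF C1_time_continuous[OF a]] continuous_intros) auto
  moreover have "usc_on ({r0 - \<rho>..r0 + \<rho>} \<times> {0..}) (\<lambda>z. U j (fst z) (snd z))"
    by (rule usc_on_subset[OF usc]) (use \<rho> in auto)
  ultimately show ?thesis unfolding f_def by (rule usc_on_diff_continuous[rotated])
qed

lemma f_bounded_above: "\<exists>M. \<forall>j r s. \<bar>r - r0\<bar> \<le> \<rho> \<longrightarrow> 0 \<le> s \<longrightarrow> s \<le> \<sigma> \<longrightarrow> f j r s \<le> M"
proof (cases "0 \<le> \<sigma>")
  case True
  have "\<exists>i. \<exists>z\<in>{r0 - \<rho>..r0 + \<rho>} \<times> {0..\<sigma>}. \<forall>j. \<forall>y\<in>{r0 - \<rho>..r0 + \<rho>} \<times> {0..\<sigma>}.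
          f j (fst y) (snd y) \<le> f i (fst z) (snd z)"
    by (rule usc_family_attains_max)
      (use \<rho> True in \<open>auto intro!: compact_Times usc_on_subset[OF usc_f]\<close>)
  then obtain i z where "\<And>j y. y \<in> {r0 - \<rho>..r0 + \<rho>} \<times> {0..\<sigma>} \<Longrightarrow>
      f j (fst y) (snd y) \<le> f i (fst z) (snd z)" by blast
  from this[of "(r, s)" j for r s j] show ?thesis
    by (intro exI[of _ "f i (fst z) (snd z)"]) (auto simp: abs_le_iff)
qed auto

lemma a'_bounded: "\<exists>B. \<forall>r. \<bar>r - r0\<bar> \<le> \<rho> \<longrightarrow> \<bar>a' r\<bar> \<le> B"
proof -
  have "continuous_on {r0 - \<rho>..r0 + \<rho>} a'"
    using a \<rho> unfolding C1_time_def by (auto elim: continuous_on_subset)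
  then have "bounded (a' ` {r0 - \<rho>..r0 + \<rho>})"
    by (intro compact_imp_bounded compact_continuous_image) auto
  then obtain B where "\<forall>r\<in>{r0 - \<rho>..r0 + \<rho>}. \<bar>a' r\<bar> \<le> B" by (auto simp: bounded_iff)
  then show ?thesis by (intro exI[of _ B]) (auto simp: abs_le_iff)
qed

text \<open>
  Upper semicontinuity spreads the strict maximum in time from the vertex to a neighbourhood of
  it.
\<close>

lemma strict_annulus:
  assumes "0 < \<rho>'" "\<rho>' \<le> \<rho>"
  obtains c where "c > 0"
    "\<And>j r s. \<rho>' \<le> \<bar>r - r0\<bar> \<Longrightarrow> \<bar>r - r0\<bar> \<le> \<rho> \<Longrightarrow> 0 \<le> s \<Longrightarrow> s \<le> c \<Longrightarrow> f j r s \<le> f0 - c"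
proof -
  define N where "N = {r0 - \<rho>..r0 - \<rho>'} \<union> {r0 + \<rho>'..r0 + \<rho>}"
  have N: "r \<in> N \<longleftrightarrow> \<rho>' \<le> \<bar>r - r0\<bar> \<and> \<bar>r - r0\<bar> \<le> \<rho>" for r
    using assms by (auto simp: N_def abs_if)
  have cN: "compact N" unfolding N_def by (intro compact_Un compact_Icc)
  have "\<exists>c>0. \<forall>r\<in>N. \<forall>s\<in>{0..c}. f j r s \<le> f0 - c" for j
  proof (rule ccontr)
    assume neg: "\<not> ?thesis"
    have "\<exists>z. z \<in> N \<times> {0..inverse (real (Suc n))} \<and> f0 - inverse (real (Suc n)) \<le> f j (fst z) (snd z)" for n
    proof -
      have "inverse (real (Suc n)) > 0" by simp
      with neg show ?thesis by (metis less_eq_real_def linorder_not_le mem_Sigma_iff fst_conv snd_conv)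
    qed
    then obtain z where z: "\<And>n. z n \<in> N \<times> {0..inverse (real (Suc n))}"
      "\<And>n. f0 - inverse (real (Suc n)) \<le> f j (fst (z n)) (snd (z n))" by metis
    have "\<And>n. fst (z n) \<in> N" using z(1) by (auto simp: mem_Times_iff)
    then obtain l \<phi> where l: "l \<in> N" "strict_mono \<phi>" "((\<lambda>n. fst (z n)) \<circ> \<phi>) \<longlonglongrightarrow> l"
      using compact_imp_seq_compact[OF cN] unfolding seq_compact_def by metis
    have inv0: "(\<lambda>n. inverse (real (Suc (\<phi> n)))) \<longlonglongrightarrow> 0"
      using LIMSEQ_subseq_LIMSEQ[OF LIMSEQ_inverse_real_of_nat l(2)] by (simp add: o_def)
    have "(\<lambda>n. snd (z (\<phi> n))) \<longlonglongrightarrow> 0"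
      by (rule tendsto_sandwich[OF _ _ tendsto_const inv0]) (use z(1) in \<open>auto simp: mem_Times_iff\<close>)
    then have lim: "(\<lambda>n. (fst (z (\<phi> n)), snd (z (\<phi> n)))) \<longlonglongrightarrow> (l, 0)"
      using l(3) by (intro tendsto_Pair) (simp_all add: o_def)
    have NS: "r \<in> {r0 - \<rho>..r0 + \<rho>}" if "r \<in> N" for r using that by (auto simp: N abs_le_iff)
    have "f0 \<le> f j (fst (l, 0::real)) (snd (l, 0::real))"
    proof (rule usc_on_limit[OF usc_f _ lim])
      show "(fst (z (\<phi> n)), snd (z (\<phi> n))) \<in> {r0 - \<rho>..r0 + \<rho>} \<times> {0..}" for n
        using z(1)[of "\<phi> n"] NS by (auto simp: mem_Times_iff)
      show "(l, 0::real) \<in> {r0 - \<rho>..r0 + \<rho>} \<times> {0..}" using NS[OF l(1)] by simp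
      show "(\<lambda>n. f0 - inverse (real (Suc (\<phi> n)))) \<longlonglongrightarrow> f0"
        using tendsto_diff[OF tendsto_const inv0, of f0] by simp
      show "f0 - inverse (real (Suc (\<phi> n))) \<le> f j (fst (fst (z (\<phi> n)), snd (z (\<phi> n))))
              (snd (fst (z (\<phi> n)), snd (z (\<phi> n))))" for n
        using z(2)[of "\<phi> n"] by simp
    qed
    moreover have "l \<noteq> r0" "\<bar>l - r0\<bar> \<le> \<rho>" using l(1) assms by (auto simp: N)
    ultimately show False using strict[of l j] by simp
  qed
  then obtain c where c: "\<And>j. c j > 0" "\<And>j r s. r \<in> N \<Longrightarrow> s \<in> {0..c j} \<Longrightarrow> f j r s \<le> f0 - c j"
    by metis
  define m where "m = Min (range c)"
  have m: "m > 0" "m \<le> c j" for j using c(1) by (auto simp: m_def)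
  show ?thesis
  proof (rule that[OF m(1)])
    fix j r s assume "\<rho>' \<le> \<bar>r - r0\<bar>" "\<bar>r - r0\<bar> \<le> \<rho>" "0 \<le> s" "s \<le> m"
    then show "f j r s \<le> f0 - m" using c(2)[of r s j] m(2)[of j] by (simp add: N)
  qed
qed

text \<open>
  Subtracting slopes \<open>p j\<close> at which all branch inequalities fail forces the maximum of a box
  around the vertex onto the vertex itself, where the inequality for \<open>F\<close> has to hold.
\<close>

lemma vertex_maximum_in_box:
  assumes \<sigma>: "\<And>j. 0 < \<sigma> j"
    and side: "\<And>j r s. \<bar>r - r0\<bar> = \<rho> \<Longrightarrow> 0 \<le> s \<Longrightarrow> s \<le> \<sigma> j \<Longrightarrow> f j r s - p j * s < f0"
    and top: "\<And>j r. \<bar>r - r0\<bar> \<le> \<rho> \<Longrightarrow> f j r (\<sigma> j) - p j * \<sigma> j < f0"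
    and H: "\<And>j r. \<bar>r - r0\<bar> \<le> \<rho> \<Longrightarrow> 0 < a' r + H j (p j)"
  obtains r where "\<bar>r - r0\<bar> < \<rho>" "a' r + F p \<le> 0"
    "\<And>j x s. \<bar>x - r0\<bar> \<le> \<rho> \<Longrightarrow> 0 \<le> s \<Longrightarrow> s \<le> \<sigma> j \<Longrightarrow> f j x s - p j * s \<le> f j r 0"
proof -
  let ?K = "\<lambda>j. {r0 - \<rho>..r0 + \<rho>} \<times> {0..\<sigma> j}"
  have "\<exists>i. \<exists>z\<in>?K i. \<forall>j. \<forall>y\<in>?K j.
          f j (fst y) (snd y) - p j * snd y \<le> f i (fst z) (snd z) - p i * snd z"
  proof (rule usc_family_attains_max)
    show "usc_on (?K i) (\<lambda>z. f i (fst z) (snd z) - p i * snd z)" for i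
      by (intro usc_on_diff_continuous usc_on_subset[OF usc_f] continuous_intros) auto
    show "?K i \<noteq> {}" for i using \<rho> \<sigma>[of i] by auto
  qed (intro compact_Times compact_Icc)
  then obtain i z where z: "z \<in> ?K i" and maxz: "\<And>j y. y \<in> ?K j \<Longrightarrow>
      f j (fst y) (snd y) - p j * snd y \<le> f i (fst z) (snd z) - p i * snd z" by blast
  obtain r s where rs: "z = (r, s)" "\<bar>r - r0\<bar> \<le> \<rho>" "0 \<le> s" "s \<le> \<sigma> i"
    using z by (auto simp: abs_le_iff)
  have max: "f j x y - p j * y \<le> f i r s - p i * s"
    if "\<bar>x - r0\<bar> \<le> \<rho>" "0 \<le> y" "y \<le> \<sigma> j" for j x y
    using maxz[of "(x, y)" j] that by (auto simp: rs(1) abs_le_iff)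
  have "f0 \<le> f i r s - p i * s" using max[of r0 0 i] \<rho> \<sigma>[of i] f_r0 by simp
  then have r: "\<bar>r - r0\<bar> < \<rho>" and s: "s < \<sigma> i"
    using side[of r s i] top[of r i] rs by (force simp: less_le)+
  have r_in: "0 < r" "r < T" using r \<rho> by (auto simp: abs_less_iff)
  have s0: "s = 0"
  proof (rule ccontr)
    assume "s \<noteq> 0"
    then have spos: "s > 0" using rs by simp
    define e where "e = min (\<rho> - \<bar>r - r0\<bar>) (min s (\<sigma> i - s))"
    have e: "e > 0" using r s spos by (simp add: e_def)
    have "a' r + H i (p i) \<le> 0"
    proof (rule branch_test[OF a C1_half_linear r_in spos e])
      fix t y assume "\<bar>t - r\<bar> < e" "0 \<le> y" "\<bar>y - s\<bar> < e"
      then have "\<bar>t - r0\<bar> \<le> \<rho>" "y \<le> \<sigma> i" by (auto simp: e_def)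
      then show "U i t y - (a t + p i * y) \<le> U i r s - (a r + p i * s)"
        using max[of t y i] \<open>0 \<le> y\<close> by (simp add: f_def)
    qed
    then show False using H[of r i] rs by simp
  qed
  define e where "e = min (\<rho> - \<bar>r - r0\<bar>) (Min (range \<sigma>))"
  have e: "e > 0" using r \<sigma> by (simp add: e_def)
  have "a' r + F (\<lambda>i. p i) \<le> 0 \<or> (\<exists>i. a' r + H i (p i) \<le> 0)"
  proof (rule vertex_test[where g = "\<lambda>i s. p i * s" and g' = "\<lambda>i s. p i" and k = i,
        OF a C1_half_linear _ r_in e])
    fix t j y assume "\<bar>t - r\<bar> < e" "0 \<le> y" "y < e"
    then have "\<bar>t - r0\<bar> \<le> \<rho>" "y \<le> \<sigma> j"
      by (auto simp: e_def intro: order_trans[OF less_imp_le])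
    then show "U j t y - (a t + p j * y) \<le> U i r 0 - (a r + p i * 0)"
      using max[of t y j] \<open>0 \<le> y\<close> s0 by (simp add: f_def)
  qed simp
  then have F: "a' r + F p \<le> 0" using H[of r] rs by (auto simp: not_le[symmetric])
  show ?thesis
  proof (rule that[OF r F])
    fix j x y assume "\<bar>x - r0\<bar> \<le> \<rho>" "0 \<le> y" "y \<le> \<sigma> j"
    then show "f j x y - p j * y \<le> f j r 0"
      using max[of x y j] s0 f_vertex_eq[of i r j] by simp
  qed
qed

text \<open>
  The heart of the proof. For \<open>p i\<close> one takes the lower slope at the vertex, along branch \<open>i\<close>, of
  \<open>s \<mapsto> sup\<^sub>r f i r s\<close>. It is finite by coercivity: a very steep line cannot stay above \<open>f\<close> while
  touching it on the branch. A line of slope close to \<open>p i\<close>, bent slightly upwards, touches \<open>f\<close>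
  from above at points of the open branch tending to the vertex. Since \<open>r0\<close> is a strict maximum in
  time, the time derivative there tends to \<open>a' r0\<close>, and \<open>H i (p i) \<le> - a' r0\<close> follows. The slopes
  \<open>q\<close> carry the junction condition; for a flux-limited \<open>F\<close> they retain the information that \<open>A \<le> -
  a' r0\<close>.
\<close>

lemma vertex_slopes:
  assumes cont: "\<And>i. continuous_on UNIV (H i)" and co: "\<And>i. coercive (H i)"
    and F_lower: "\<And>i B. \<exists>R. \<forall>p. p i \<le> R \<longrightarrow> B < F p"
  obtains q p where "F q \<le> - a' r0" "\<And>i. H i (p i) \<le> - a' r0"
    "\<And>i \<delta>. \<delta> > 0 \<Longrightarrow> \<exists>\<sigma>>0. \<forall>s. 0 < s \<longrightarrow> s \<le> \<sigma> \<longrightarrow>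
       (\<exists>r. \<bar>r - r0\<bar> \<le> \<rho> \<and> f0 + (p i - \<delta>) * s \<le> f i r s)"
proof -
  obtain c where c: "c > 0" and side: "\<And>j r s. \<rho> \<le> \<bar>r - r0\<bar> \<Longrightarrow> \<bar>r - r0\<bar> \<le> \<rho> \<Longrightarrow> 0 \<le> s \<Longrightarrow>
      s \<le> c \<Longrightarrow> f j r s \<le> f0 - c"
    using strict_annulus[of \<rho>] \<rho> by auto
  obtain M where M: "\<And>j r s. \<bar>r - r0\<bar> \<le> \<rho> \<Longrightarrow> 0 \<le> s \<Longrightarrow> s \<le> c \<Longrightarrow> f j r s \<le> M"
    using f_bounded_above[of c] by blast
  obtain B where B: "\<And>r. \<bar>r - r0\<bar> \<le> \<rho> \<Longrightarrow> \<bar>a' r\<bar> \<le> B" using a'_bounded by blast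
  have "\<forall>j. \<exists>R. \<forall>p. R \<le> \<bar>p\<bar> \<longrightarrow> B < H j p" using coercive_bound[OF co] by blast
  then obtain R where R: "\<And>j p. R j \<le> \<bar>p\<bar> \<Longrightarrow> B < H j p" by metis
  define Q where "Q = max 1 (max (Max (range R)) ((M - f0) / c + 1))"
  have "R j \<le> Max (range R)" for j by simp
  then have Q: "Q > 0" "R j \<le> Q" "(M - f0) / c < Q" for j
    by (simp_all add: Q_def le_max_iff_disj less_max_iff_disj)
  have Qc: "M - Q * c < f0" using Q(3) c by (simp add: pos_divide_less_eq)
  have HQ: "0 < a' r + H j Q" if "\<bar>r - r0\<bar> \<le> \<rho>" for j r
    using R[of j Q] Q(1) Q(2)[of j] B[OF that] by (simp add: abs_le_iff)
  \<comment> \<open>Lines of the large slope \<open>Q\<close> on all branches give the upper slope bound and the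
    inequality for \<open>F\<close>.\<close>
  obtain x where x: "\<bar>x - r0\<bar> < \<rho>" "a' x + F (\<lambda>_. Q) \<le> 0"
    "\<And>j r s. \<bar>r - r0\<bar> \<le> \<rho> \<Longrightarrow> 0 \<le> s \<Longrightarrow> s \<le> c \<Longrightarrow> f j r s - Q * s \<le> f j x 0"
  proof (rule vertex_maximum_in_box[of "\<lambda>_. c" "\<lambda>_. Q"])
    show "f j r s - Q * s < f0" if "\<bar>r - r0\<bar> = \<rho>" "0 \<le> s" "s \<le> c" for j r s
    proof -
      have "Q * s \<ge> 0" using Q(1) that by simp
      then show ?thesis using side[of r s j] that c by simp
    qed
    show "f j r c - Q * c < f0" if "\<bar>r - r0\<bar> \<le> \<rho>" for j r
      using M[OF that, of c j] c Qc by simp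
  qed (use c HQ in auto)
  have "x = r0"
  proof (rule ccontr)
    assume "x \<noteq> r0"
    then have "f undefined x 0 < f0" using strict[of x undefined] x(1) by simp
    then show False using x(3)[of r0 0 undefined] f_r0 \<rho> c by simp
  qed
  with x(2) have FQ: "F (\<lambda>_. Q) \<le> - a' r0" by simp
  have upper: "f j r s \<le> f0 + Q * s" if "\<bar>r - r0\<bar> \<le> \<rho>" "0 \<le> s" "s \<le> c" for j r s
    using x(3)[OF that, of j] \<open>x = r0\<close> f_r0 by simp
  \<comment> \<open>The lower slope is the supremum of all \<open>q\<close> such that the line of slope \<open>q\<close> stays
    below \<open>sup\<^sub>r f i r s\<close> near the vertex.\<close>
  define good where "good i q \<longleftrightarrow> (\<exists>\<sigma>>0. \<forall>s. 0 < s \<longrightarrow> s \<le> \<sigma> \<longrightarrow>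
       (\<exists>r. \<bar>r - r0\<bar> \<le> \<rho> \<and> f0 + q * s \<le> f i r s))" for i q
  have good_le: "q \<le> Q" if "good i q" for i q
  proof -
    obtain \<sigma> where \<sigma>: "\<sigma> > 0" "\<And>s. 0 < s \<Longrightarrow> s \<le> \<sigma> \<Longrightarrow> \<exists>r. \<bar>r - r0\<bar> \<le> \<rho> \<and> f0 + q * s \<le> f i r s"
      using \<open>good i q\<close> unfolding good_def by blast
    define s where "s = min \<sigma> c"
    have s: "0 < s" "s \<le> \<sigma>" "s \<le> c" using \<sigma> c by (auto simp: s_def)
    obtain r where "\<bar>r - r0\<bar> \<le> \<rho>" "f0 + q * s \<le> f i r s" using \<sigma>(2)[OF s(1,2)] by blast
    then have "q * s \<le> Q * s" using upper[of r s i] s by linarith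
    then show ?thesis using s(1) by simp
  qed
  have good_ex: "\<exists>P. good i P" for i
  proof -
    obtain R' where R': "\<And>p. p i \<le> R' \<Longrightarrow> B < F p" using F_lower[of i B] by blast
    \<comment> \<open>A very negative slope makes both \<open>H i\<close> and \<open>F\<close> large. If the graph fell below the
      line of slope \<open>P\<close> at arbitrarily small \<open>s1\<close>, the box with edge \<open>s1\<close> on branch \<open>i\<close>
      would have its maximum at the vertex and contradict the junction condition.\<close>
    define P where "P = min (- 1) (min R' (- R i))"
    have P: "P < 0" "P \<le> R'" "R i \<le> \<bar>P\<bar>" by (auto simp: P_def)
    have "good i P"
    proof (rule ccontr)
      assume "\<not> good i P"
      moreover define \<sigma> where "\<sigma> = min c (c / (2 * \<bar>P\<bar>))"
      moreover have "\<sigma> > 0" using c P by (simp add: \<sigma>_def divide_less_0_iff)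
      ultimately obtain s1 where s1: "0 < s1" "s1 \<le> \<sigma>"
        and less: "\<And>r. \<bar>r - r0\<bar> \<le> \<rho> \<Longrightarrow> f i r s1 < f0 + P * s1"
        unfolding good_def by (meson not_le)
      have "2 * \<bar>P\<bar> > 0" "s1 \<le> c / (2 * \<bar>P\<bar>)"
        using s1(2) P(1) unfolding \<sigma>_def by linarith+
      then have Ps1: "\<bar>P\<bar> * s1 \<le> c / 2"
        by (simp only: pos_le_divide_eq) (simp add: mult_ac)
      define p where "p j = (if j = i then P else Q)" for j
      define \<sigma>' where "\<sigma>' j = (if j = i then s1 else c)" for j
      obtain r where r: "\<bar>r - r0\<bar> < \<rho>" "a' r + F p \<le> 0"
      proof (rule vertex_maximum_in_box[of \<sigma>' p])
        show "0 < \<sigma>' j" for j using s1 c by (simp add: \<sigma>'_def)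
        show "f j r s - p j * s < f0" if "\<bar>r - r0\<bar> = \<rho>" "0 \<le> s" "s \<le> \<sigma>' j" for j r s
        proof (cases "j = i")
          case True
          then have "\<bar>P\<bar> * s \<le> c / 2"
            using mult_left_mono[of s s1 "\<bar>P\<bar>"] that Ps1 by (simp add: \<sigma>'_def del: mult_le_cancel_left)
          moreover have "s \<le> c" using True that s1 by (simp add: \<sigma>'_def \<sigma>_def)
          ultimately have "f j r s \<le> f0 - c" "- (P * s) \<le> c / 2"
            using side[of r s j] that P(1) by (simp_all add: abs_of_neg)
          then show ?thesis using c True by (simp add: p_def)
        next
          case False
          have "Q * s \<ge> 0" using Q(1) that by simp
          then show ?thesis using side[of r s j] that c False by (simp add: p_def \<sigma>'_def)
        qed
        show "f j r (\<sigma>' j) - p j * \<sigma>' j < f0" if "\<bar>r - r0\<bar> \<le> \<rho>" for j r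
          using less[OF that] M[OF that, of c j] c Qc by (auto simp: p_def \<sigma>'_def)
        show "0 < a' r + H j (p j)" if "\<bar>r - r0\<bar> \<le> \<rho>" for j r
          using HQ[OF that, of j] R[OF P(3)] B[OF that] by (auto simp: p_def abs_le_iff)
      qed auto
      have "B < F p" by (rule R') (simp add: p_def P)
      moreover have "\<bar>a' r\<bar> \<le> B" using B r(1) by simp
      ultimately show False using r(2) by linarith
    qed
    then show ?thesis by blast
  qed
  define p where "p i = Sup {q. good i q}" for i
  have bdd: "bdd_above {q. good i q}" for i using good_le by (intro bdd_aboveI) auto
  have good_p: "good i (p i - \<delta>)" if "\<delta> > 0" for i \<delta>
  proof -
    have "p i - \<delta> < Sup {q. good i q}" using that by (simp add: p_def)
    then obtain q where q: "good i q" "p i - \<delta> < q"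
      using less_cSup_iff[OF _ bdd] good_ex by auto
    have "(p i - \<delta>) * s \<le> q * s" if "0 < s" for s using q that by (intro mult_right_mono) auto
    with q(1) show ?thesis unfolding good_def by (meson add_left_mono order_trans)
  qed
  have not_good_p: "\<not> good i (p i + \<delta>)" if "\<delta> > 0" for i \<delta>
    using cSup_upper[OF _ bdd, of "p i + \<delta>" i] that by (auto simp: p_def)
  have Hp: "H i (p i) \<le> - a' r0" for i
  proof (rule ccontr)
    assume "\<not> H i (p i) \<le> - a' r0"
    define m where "m = a' r0 + H i (p i)"
    have m: "m > 0" using \<open>\<not> H i (p i) \<le> - a' r0\<close> by (simp add: m_def)
    have "isCont (H i) (p i)" using cont by (simp add: continuous_on_eq_continuous_at)
    then obtain \<kappa>' where \<kappa>': "\<kappa>' > 0" "\<And>x. \<bar>x - p i\<bar> < \<kappa>' \<Longrightarrow> \<bar>H i x - H i (p i)\<bar> < m / 2"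
      using m unfolding continuous_at_eps_delta dist_real_def by (metis half_gt_zero)
    define \<kappa> where "\<kappa> = \<kappa>' / 2"
    have \<kappa>: "\<kappa> > 0" "\<And>x. \<bar>x - p i\<bar> \<le> \<kappa> \<Longrightarrow> \<bar>H i x - H i (p i)\<bar> < m / 2"
      using \<kappa>' by (auto simp: \<kappa>_def)
    have "r0 \<in> {0<..<T}" using \<rho> by simp
    then have "isCont a' r0"
      using a unfolding C1_time_def by (metis continuous_on_eq_continuous_at open_greaterThanLessThan)
    then obtain \<rho>'' where \<rho>'': "\<rho>'' > 0" "\<And>r. \<bar>r - r0\<bar> < \<rho>'' \<Longrightarrow> \<bar>a' r - a' r0\<bar> < m / 2"
      using m unfolding continuous_at_eps_delta dist_real_def by (metis half_gt_zero)
    define \<rho>' where "\<rho>' = min \<rho> \<rho>''"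
    have \<rho>': "0 < \<rho>'" "\<rho>' \<le> \<rho>" using \<rho> \<rho>'' by (auto simp: \<rho>'_def)
    have pos: "0 < a' r + H i x" if "\<bar>r - r0\<bar> < \<rho>'" "\<bar>x - p i\<bar> \<le> \<kappa>" for r x
    proof -
      have "\<bar>a' r - a' r0\<bar> < m / 2" using \<rho>''(2)[of r] that(1) by (simp add: \<rho>'_def)
      with \<kappa>(2)[OF that(2)] m_def show ?thesis by linarith
    qed
    obtain c' where c': "c' > 0" and annulus: "\<And>j r s. \<rho>' \<le> \<bar>r - r0\<bar> \<Longrightarrow> \<bar>r - r0\<bar> \<le> \<rho> \<Longrightarrow> 0 \<le> s \<Longrightarrow>
        s \<le> c' \<Longrightarrow> f j r s \<le> f0 - c'"
      using strict_annulus[OF \<rho>'] by blast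
    \<comment> \<open>The graph is above the line of slope \<open>p i - \<delta>\<close> on all of \<open>{0..s1}\<close> and below the
      line of slope \<open>p i + \<delta>\<close> at \<open>s1\<close>. The parabola \<open>g\<close> gains \<open>\<kappa> * s1 / 4\<close> at both ends
      relative to the midpoint, which exceeds the errors of order \<open>\<delta> * s1\<close>; its slopes
      differ from \<open>p i\<close> by at most \<open>\<kappa>\<close>.\<close>
    define \<delta> where "\<delta> = \<kappa> / 16"
    have \<delta>: "\<delta> > 0" using \<kappa> by (simp add: \<delta>_def)
    obtain \<sigma> where \<sigma>: "\<sigma> > 0" "\<And>s. 0 < s \<Longrightarrow> s \<le> \<sigma> \<Longrightarrow>
        \<exists>r. \<bar>r - r0\<bar> \<le> \<rho> \<and> f0 + (p i - \<delta>) * s \<le> f i r s"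
      using good_p[OF \<delta>, of i] unfolding good_def by blast
    define \<tau> where "\<tau> = min \<sigma> (min c' (c' / (2 * (\<bar>p i\<bar> + \<kappa>))))"
    have "\<tau> > 0" using \<sigma> c' \<kappa> by (simp add: \<tau>_def add_nonneg_pos)
    then obtain s1 where s1: "0 < s1" "s1 \<le> \<tau>"
      and less: "\<And>r. \<bar>r - r0\<bar> \<le> \<rho> \<Longrightarrow> f i r s1 < f0 + (p i + \<delta>) * s1"
      using not_good_p[OF \<delta>, of i] unfolding good_def by (meson not_le)
    have s1': "s1 \<le> \<sigma>" "s1 \<le> c'" "(\<bar>p i\<bar> + \<kappa>) * s1 \<le> c' / 2"
    proof -
      show "s1 \<le> \<sigma>" "s1 \<le> c'" using s1(2) by (auto simp: \<tau>_def)
      have "s1 \<le> c' / (2 * (\<bar>p i\<bar> + \<kappa>))" using s1(2) by (simp add: \<tau>_def)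
      moreover have "\<bar>p i\<bar> + \<kappa> > 0" using \<kappa> by simp
      ultimately show "(\<bar>p i\<bar> + \<kappa>) * s1 \<le> c' / 2" by (simp add: field_simps)
    qed
    define g where "g s = (\<kappa> / s1) * s\<^sup>2 + (p i - \<kappa>) * s + \<kappa> * s1 / 4" for s
    define g' where "g' s = 2 * (\<kappa> / s1) * s + (p i - \<kappa>)" for s
    have gC1: "C1_half g g'" unfolding g_def g'_def by (rule C1_half_quadratic)
    have g_alt: "g s = p i * s + \<kappa> / s1 * (s - s1 / 2)\<^sup>2" for s
      using s1(1) by (simp add: g_def field_simps power2_eq_square)
    have g_ge: "p i * s \<le> g s" for s using s1(1) \<kappa>(1) by (simp add: g_alt)
    have g_val: "g 0 = \<kappa> * s1 / 4" "g s1 = p i * s1 + \<kappa> * s1 / 4" "g (s1 / 2) = p i * s1 / 2"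
      using s1(1) by (simp_all add: g_alt field_simps power2_eq_square)
    let ?K = "{r0 - \<rho>..r0 + \<rho>} \<times> {0..s1}"
    have "\<exists>z\<in>?K. \<forall>y\<in>?K. f i (fst y) (snd y) - g (snd y) \<le> f i (fst z) (snd z) - g (snd z)"
    proof (rule usc_on_attains_max)
      show "usc_on ?K (\<lambda>z. f i (fst z) (snd z) - g (snd z))"
        unfolding g_def
        by (intro usc_on_diff_continuous usc_on_subset[OF usc_f] continuous_intros) auto
      show "?K \<noteq> {}" using \<rho> s1 by auto
    qed (intro compact_Times compact_Icc)
    then obtain z where z: "z \<in> ?K" and maxz: "\<And>y. y \<in> ?K \<Longrightarrow>
        f i (fst y) (snd y) - g (snd y) \<le> f i (fst z) (snd z) - g (snd z)" by blast
    obtain r s where rs: "z = (r, s)" "\<bar>r - r0\<bar> \<le> \<rho>" "0 \<le> s" "s \<le> s1"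
      using z by (auto simp: abs_le_iff)
    have max: "f i x y - g y \<le> f i r s - g s" if "\<bar>x - r0\<bar> \<le> \<rho>" "0 \<le> y" "y \<le> s1" for x y
      using maxz[of "(x, y)"] that by (auto simp: rs(1) abs_le_iff)
    have big: "f0 - \<delta> * s1 / 2 \<le> f i r s - g s"
    proof -
      obtain x where "\<bar>x - r0\<bar> \<le> \<rho>" "f0 + (p i - \<delta>) * (s1 / 2) \<le> f i x (s1 / 2)"
        using \<sigma>(2)[of "s1 / 2"] s1(1) s1'(1) by auto
      then show ?thesis using max[of x "s1 / 2"] s1(1)
        by (simp add: g_val algebra_simps add_divide_distrib diff_divide_distrib)
    qed
    have \<kappa>s: "\<delta> * s1 = \<kappa> * s1 / 16" "0 < \<kappa> * s1" using \<kappa> s1 by (auto simp: \<delta>_def)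
    have r: "\<bar>r - r0\<bar> < \<rho>'"
    proof (rule ccontr)
      assume "\<not> \<bar>r - r0\<bar> < \<rho>'"
      then have "f i r s \<le> f0 - c'" using annulus[of r s i] rs s1' by simp
      moreover have "- p i * s \<le> \<bar>p i\<bar> * s1" using rs by (intro mult_mono) auto
      ultimately show False
        using big g_ge[of s] s1'(3) c' \<kappa>s by (simp add: algebra_simps)
    qed
    have s: "0 < s" "s < s1"
    proof -
      have "s \<noteq> 0" using big f_vertex_le[OF rs(2), of i] \<kappa>s by (auto simp: g_val)
      then show "0 < s" using rs by simp
      have "s \<noteq> s1" using big less[OF rs(2)] \<kappa>s by (auto simp: g_val algebra_simps)
      then show "s < s1" using rs by simp
    qed
    define e where "e = min (\<rho>' - \<bar>r - r0\<bar>) (min s (s1 - s))"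
    have e: "e > 0" using r s by (simp add: e_def)
    have r_in: "0 < r" "r < T" using rs(2) \<rho> by (auto simp: abs_le_iff)
    have "a' r + H i (g' s) \<le> 0"
    proof (rule branch_test[OF a gC1 r_in s(1) e])
      fix t y assume "\<bar>t - r\<bar> < e" "0 \<le> y" "\<bar>y - s\<bar> < e"
      then have "\<bar>t - r0\<bar> \<le> \<rho>" "y \<le> s1" using \<rho>' by (auto simp: e_def)
      then show "U i t y - (a t + g y) \<le> U i r s - (a r + g s)"
        using max[of t y] \<open>0 \<le> y\<close> by (simp add: f_def)
    qed
    moreover have "\<bar>g' s - p i\<bar> \<le> \<kappa>"
    proof -
      have "0 \<le> 2 * (\<kappa> / s1) * s" using \<kappa>(1) s1(1) s by simp
      moreover have "2 * (\<kappa> / s1) * s \<le> 2 * \<kappa>"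
        using \<kappa>(1) s1(1) s by (simp add: field_simps)
      ultimately show ?thesis by (simp add: g'_def abs_le_iff)
    qed
    ultimately show False using pos[OF r] by (simp add: not_le[symmetric])
  qed
  show ?thesis
    by (rule that[OF FQ Hp]) (use good_p in \<open>simp add: good_def\<close>)
qed

end

end

section \<open>Doubling variables inside a branch\<close>

lemma C1_half_add: "C1_half f f' \<Longrightarrow> C1_half g g' \<Longrightarrow> C1_half (\<lambda>s. f s + g s) (\<lambda>s. f' s + g' s)"
  unfolding C1_half_def by (auto intro!: derivative_intros continuous_intros)

lemma C1_time_add: "C1_time T f f' \<Longrightarrow> C1_time T g g' \<Longrightarrow> C1_time T (\<lambda>s. f s + g s) (\<lambda>s. f' s + g' s)"
  unfolding C1_time_def by (auto intro!: derivative_intros continuous_intros)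

lemma C1_half_square: "C1_half (\<lambda>s. A * (s - c)\<^sup>2) (\<lambda>s. 2 * A * (s - c))"
  unfolding C1_half_def by (auto intro!: derivative_eq_intros continuous_intros)

lemma C1_time_square: "C1_time T (\<lambda>s. A * (s - c)\<^sup>2) (\<lambda>s. 2 * A * (s - c))"
  unfolding C1_time_def by (auto intro!: derivative_eq_intros continuous_intros)

lemma C1_time_reciprocal: "C1_time T (\<lambda>t. \<eta> / (T - t)) (\<lambda>t. \<eta> / (T - t)\<^sup>2)"
  using C1_time_penalty[of T \<eta> 0 0 0] by simp

text \<open>
  The classical argument for one space variable on the half-line. The squares centred at the given
  maximum make it strict, so that the maximum points of the functions with separate variables \<open>x\<close>,
  \<open>y\<close> converge to it. The doubled slopes \<open>n * (x - y)\<close> are bounded by coercivity, and \<open>P\<close> is a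
  limit of them.
\<close>

lemma interior_doubling:
  fixes U W :: "'n::finite \<Rightarrow> real \<Rightarrow> real \<Rightarrow> real"
  assumes U: "junction_subsolution T H F U" and W: "junction_subsolution T Hd Fd W"
    and cont: "continuous_on UNIV (H i)" "continuous_on UNIV (Hd i)" and co: "coercive (H i)"
    and r0: "0 < r0" "r0 < T" and s0: "0 < s0" "s0 < T" and x0: "0 < x0" and \<epsilon>: "0 < \<epsilon>"
    and max: "\<And>r s x. 0 < r \<Longrightarrow> r < T \<Longrightarrow> 0 < s \<Longrightarrow> s < T \<Longrightarrow> 0 < x \<Longrightarrow>
       U i r x + W i s x - (\<eta> / (T - r) + \<eta> / (T - s) + 1 / (2 * \<epsilon>) * (r - s)\<^sup>2 + \<alpha> * x\<^sup>2) \<le>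
       U i r0 x0 + W i s0 x0 - (\<eta> / (T - r0) + \<eta> / (T - s0) + 1 / (2 * \<epsilon>) * (r0 - s0)\<^sup>2 + \<alpha> * x0\<^sup>2)"
  shows "\<exists>P. H i (P + 2 * \<alpha> * x0) \<le> - (\<eta> / (T - r0)\<^sup>2 + (r0 - s0) / \<epsilon>) \<and>
             Hd i (- P) \<le> - (\<eta> / (T - s0)\<^sup>2 + (s0 - r0) / \<epsilon>)"
proof -
  interpret U: junction_subsolution T H F U by (rule U)
  interpret W: junction_subsolution T Hd Fd W by (rule W)
  define \<Phi>0 where "\<Phi>0 = U i r0 x0 + W i s0 x0 -
    (\<eta> / (T - r0) + \<eta> / (T - s0) + 1 / (2 * \<epsilon>) * (r0 - s0)\<^sup>2 + \<alpha> * x0\<^sup>2)"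
  define m where "m = min x0 (min (min r0 (T - r0)) (min s0 (T - s0)))"
  have m: "0 < m" "m \<le> x0" "m \<le> r0" "m \<le> T - r0" "m \<le> s0" "m \<le> T - s0"
    using r0 s0 x0 by (auto simp: m_def)
  define \<rho> where "\<rho> = m / 2"
  have \<rho>: "0 < \<rho>" "\<rho> < r0" "\<rho> < s0" "\<rho> < x0" "r0 + \<rho> < T" "s0 + \<rho> < T"
    using m unfolding \<rho>_def by linarith+
  define K where "K = ({r0 - \<rho>..r0 + \<rho>} \<times> {s0 - \<rho>..s0 + \<rho>}) \<times> ({x0 - \<rho>..x0 + \<rho>} \<times> {x0 - \<rho>..x0 + \<rho>})"
  have cK: "compact K" unfolding K_def by (intro compact_Times compact_Icc)
  have K_iff: "((r, s), (x, y)) \<in> K \<longleftrightarrow> \<bar>r - r0\<bar> \<le> \<rho> \<and> \<bar>s - s0\<bar> \<le> \<rho> \<and> \<bar>x - x0\<bar> \<le> \<rho> \<and> \<bar>y - x0\<bar> \<le> \<rho>" for r s x y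
    by (auto simp: K_def abs_le_iff)
  define z0 where "z0 = ((r0, s0), (x0, x0))"
  have z0: "z0 \<in> K" using \<rho> by (simp add: z0_def K_iff)
  define G where "G z = U i (fst (fst z)) (fst (snd z)) + W i (snd (fst z)) (snd (snd z)) -
     (\<eta> / (T - fst (fst z)) + \<eta> / (T - snd (fst z)) + 1 / (2 * \<epsilon>) * (fst (fst z) - snd (fst z))\<^sup>2
      + \<alpha> * (fst (snd z))\<^sup>2 + 1 * (fst (fst z) - r0)\<^sup>2 + 1 * (snd (fst z) - s0)\<^sup>2 + 1 * (fst (snd z) - x0)\<^sup>2)" for z
  have uscU: "usc_on K (\<lambda>z. U i (fst (fst z)) (fst (snd z)))"
    using usc_on_compose[OF U.usc, of K "\<lambda>z. (fst (fst z), fst (snd z))" i] \<rho>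
    by (force simp: K_def intro!: continuous_intros)
  have uscW: "usc_on K (\<lambda>z. W i (snd (fst z)) (snd (snd z)))"
    using usc_on_compose[OF W.usc, of K "\<lambda>z. (snd (fst z), snd (snd z))" i] \<rho>
    by (force simp: K_def intro!: continuous_intros)
  have uscG: "usc_on K G"
    unfolding G_def
    by (intro usc_on_diff_continuous usc_on_add uscU uscW continuous_intros) (use \<rho> in \<open>auto simp: K_def\<close>)
  define Q where "Q n z = real n / 2 * (fst (snd z) - snd (snd z))\<^sup>2" for n and z :: "(real \<times> real) \<times> (real \<times> real)"
  have "\<exists>z\<in>K. \<forall>y\<in>K. G y - Q n y \<le> G z - Q n z" for n
    by (rule usc_on_attains_max[OF cK])
      (use z0 in \<open>auto simp: Q_def intro!: usc_on_diff_continuous uscG continuous_intros\<close>)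
  then obtain z where z: "\<And>n. z n \<in> K" and zmax: "\<And>n y. y \<in> K \<Longrightarrow> G y - Q n y \<le> G (z n) - Q n (z n)"
    by metis
  have G0: "G z0 = \<Phi>0" "Q n z0 = 0" for n by (simp_all add: G_def Q_def z0_def \<Phi>0_def)
  have Gz: "\<Phi>0 + Q n (z n) \<le> G (z n)" for n using zmax[OF z0, of n] G0 by simp
  obtain M where M: "\<And>y. y \<in> K \<Longrightarrow> G y \<le> M"
    using usc_on_attains_max[OF cK _ uscG] z0 by (metis empty_iff)
  obtain l \<phi> where l: "l \<in> K" "strict_mono \<phi>" "(z \<circ> \<phi>) \<longlonglongrightarrow> l"
    using compact_imp_seq_compact[OF cK] z unfolding seq_compact_def by metis
  obtain r1 s1 x1 y1 where l_eq: "l = ((r1, s1), (x1, y1))" by (metis surj_pair)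
  have lim: "(\<lambda>n. fst (fst (z (\<phi> n)))) \<longlonglongrightarrow> r1" "(\<lambda>n. snd (fst (z (\<phi> n)))) \<longlonglongrightarrow> s1"
    "(\<lambda>n. fst (snd (z (\<phi> n)))) \<longlonglongrightarrow> x1" "(\<lambda>n. snd (snd (z (\<phi> n)))) \<longlonglongrightarrow> y1"
    using tendsto_fst[OF tendsto_fst[OF l(3)]] tendsto_snd[OF tendsto_fst[OF l(3)]]
      tendsto_fst[OF tendsto_snd[OF l(3)]] tendsto_snd[OF tendsto_snd[OF l(3)]]
    by (simp_all add: l_eq o_def)
  have \<phi>_le: "n \<le> \<phi> n" for n using l(2) by (rule seq_suble)
  have "x1 = y1"
  proof -
    have "(fst (snd (z (\<phi> n))) - snd (snd (z (\<phi> n))))\<^sup>2 \<le> 2 * (M - \<Phi>0) * inverse (real n)" if "n > 0" for n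
    proof -
      have pos: "real (\<phi> n) > 0" "inverse (real (\<phi> n)) \<le> inverse (real n)"
        using \<phi>_le[of n] that by auto
      have "M - \<Phi>0 \<ge> 0" using M[OF z0] G0 by simp
      have "Q (\<phi> n) (z (\<phi> n)) \<le> M - \<Phi>0" using Gz[of "\<phi> n"] M[OF z[of "\<phi> n"]] by simp
      then have "(fst (snd (z (\<phi> n))) - snd (snd (z (\<phi> n))))\<^sup>2 \<le> 2 * (M - \<Phi>0) * inverse (real (\<phi> n))"
        using pos(1) by (simp add: Q_def field_simps)
      also have "\<dots> \<le> 2 * (M - \<Phi>0) * inverse (real n)"
        using pos(2) \<open>M - \<Phi>0 \<ge> 0\<close> by (intro mult_left_mono) auto
      finally show ?thesis .
    qed
    then have ev: "eventually (\<lambda>n. (fst (snd (z (\<phi> n))) - snd (snd (z (\<phi> n))))\<^sup>2 \<le> 2 * (M - \<Phi>0) * inverse (real n)) sequentially"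
      using eventually_gt_at_top[of "0::nat"] by (rule eventually_mono[rotated])
    have "(\<lambda>n. 2 * (M - \<Phi>0) * inverse (real n)) \<longlonglongrightarrow> 2 * (M - \<Phi>0) * 0"
      by (intro tendsto_mult tendsto_const lim_inverse_n)
    moreover have "(\<lambda>n. (fst (snd (z (\<phi> n))) - snd (snd (z (\<phi> n))))\<^sup>2) \<longlonglongrightarrow> (x1 - y1)\<^sup>2"
      by (intro tendsto_intros lim)
    ultimately have "(x1 - y1)\<^sup>2 \<le> 2 * (M - \<Phi>0) * 0"
      using ev by (intro tendsto_le[OF sequentially_bot])
    then show ?thesis by simp
  qed
  have "\<Phi>0 \<le> G l"
  proof (rule usc_on_limit[OF uscG _ l(3) l(1) tendsto_const])
    show "(z \<circ> \<phi>) n \<in> K" for n using z by simp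
    have "0 \<le> Q n y" for n y by (simp add: Q_def)
    then show "\<Phi>0 \<le> G ((z \<circ> \<phi>) n)" for n using Gz[of "\<phi> n"] by (smt (verit) o_apply)
  qed
  moreover have "G l + ((r1 - r0)\<^sup>2 + (s1 - s0)\<^sup>2 + (x1 - x0)\<^sup>2) \<le> \<Phi>0"
  proof -
    have "\<bar>r1 - r0\<bar> \<le> \<rho>" "\<bar>s1 - s0\<bar> \<le> \<rho>" "\<bar>x1 - x0\<bar> \<le> \<rho>" using l(1) by (auto simp: l_eq K_iff)
    then have "0 < r1" "r1 < T" "0 < s1" "s1 < T" "0 < x1" using \<rho> by (auto simp: abs_le_iff)
    from max[OF this] show ?thesis
      by (simp add: G_def l_eq \<open>x1 = y1\<close>[symmetric] \<Phi>0_def)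
  qed
  ultimately have "(r1 - r0)\<^sup>2 + (s1 - s0)\<^sup>2 + (x1 - x0)\<^sup>2 \<le> 0" by simp
  then have "(r1 - r0)\<^sup>2 = 0" "(s1 - s0)\<^sup>2 = 0" "(x1 - x0)\<^sup>2 = 0"
    using zero_le_power2[of "r1 - r0"] zero_le_power2[of "s1 - s0"] zero_le_power2[of "x1 - x0"]
    by linarith+
  then have eqs: "r1 = r0" "s1 = s0" "x1 = x0" "y1 = x0" using \<open>x1 = y1\<close> by simp_all
  define r s x y where "r n = fst (fst (z (\<phi> n)))" and "s n = snd (fst (z (\<phi> n)))"
    and "x n = fst (snd (z (\<phi> n)))" and "y n = snd (snd (z (\<phi> n)))" for n
  have z_eq: "z (\<phi> n) = ((r n, s n), (x n, y n))" for n by (simp add: r_def s_def x_def y_def)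
  have lim: "r \<longlonglongrightarrow> r0" "s \<longlonglongrightarrow> s0" "x \<longlonglongrightarrow> x0" "y \<longlonglongrightarrow> x0"
    using lim unfolding eqs r_def s_def x_def y_def by simp_all
  define P where "P n = real (\<phi> n) * (x n - y n)" for n
  define q where "q n = 2 * \<alpha> * x n + 2 * (x n - x0)" for n
  define A where "A n = - (\<eta> / (T - r n)\<^sup>2 + (r n - s n) / \<epsilon> + 2 * (r n - r0))" for n
  define B where "B n = - (\<eta> / (T - s n)\<^sup>2 + (s n - r n) / \<epsilon> + 2 * (s n - s0))" for n
  have ev: "eventually (\<lambda>n. \<bar>r n - r0\<bar> < \<rho>) sequentially" "eventually (\<lambda>n. \<bar>s n - s0\<bar> < \<rho>) sequentially"
    "eventually (\<lambda>n. \<bar>x n - x0\<bar> < \<rho>) sequentially" "eventually (\<lambda>n. \<bar>y n - x0\<bar> < \<rho>) sequentially"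
    using lim[THEN tendstoD, OF \<rho>(1)] by (simp_all add: dist_real_def)
  have ineq: "eventually (\<lambda>n. H i (P n + q n) \<le> A n \<and> Hd i (- P n) \<le> B n) sequentially"
    using ev
  proof eventually_elim
    case (elim n)
    define e where "e = min (min (\<rho> - \<bar>r n - r0\<bar>) (\<rho> - \<bar>s n - s0\<bar>)) (min (\<rho> - \<bar>x n - x0\<bar>) (\<rho> - \<bar>y n - x0\<bar>))"
    have e: "e > 0" using elim by (simp add: e_def)
    have in_T: "0 < r n" "r n < T" "0 < s n" "s n < T" "0 < x n" "0 < y n"
      using elim \<rho> by (auto simp: abs_less_iff)
    have zm: "G ((t, \<tau>), (\<xi>, \<zeta>)) - Q (\<phi> n) ((t, \<tau>), (\<xi>, \<zeta>)) \<le> G ((r n, s n), (x n, y n)) - Q (\<phi> n) ((r n, s n), (x n, y n))"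
      if "\<bar>t - r n\<bar> < e" "\<bar>\<tau> - s n\<bar> < e" "\<bar>\<xi> - x n\<bar> < e" "\<bar>\<zeta> - y n\<bar> < e" for t \<tau> \<xi> \<zeta>
    proof -
      have tri: "\<bar>a - c\<bar> \<le> \<rho>" if "\<bar>a - b\<bar> < e" "e \<le> \<rho> - \<bar>b - c\<bar>" for a b c :: real
        using that by linarith
      have "((t, \<tau>), (\<xi>, \<zeta>)) \<in> K"
        unfolding K_iff by (intro conjI tri[OF that(1)] tri[OF that(2)] tri[OF that(3)] tri[OF that(4)])
          (simp_all add: e_def min_le_iff_disj)
      then show ?thesis unfolding z_eq[symmetric] by (rule zmax)
    qed
    have "(\<eta> / (T - r n)\<^sup>2 + 2 * (1 / (2 * \<epsilon>)) * (r n - s n)) + 2 * 1 * (r n - r0) +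
        H i ((2 * \<alpha> * (x n - 0) + 2 * 1 * (x n - x0)) + 2 * (real (\<phi> n) / 2) * (x n - y n)) \<le> 0"
    proof (rule U.branch_test[OF C1_time_add[OF C1_time_add[OF C1_time_reciprocal C1_time_square] C1_time_square]
          C1_half_add[OF C1_half_add[OF C1_half_square C1_half_square] C1_half_square] in_T(1,2,5) e])
      fix t \<xi> assume "\<bar>t - r n\<bar> < e" "\<bar>\<xi> - x n\<bar> < e"
      then show "U i t \<xi> - (\<eta> / (T - t) + 1 / (2 * \<epsilon>) * (t - s n)\<^sup>2 + 1 * (t - r0)\<^sup>2 +
          (\<alpha> * (\<xi> - 0)\<^sup>2 + 1 * (\<xi> - x0)\<^sup>2 + real (\<phi> n) / 2 * (\<xi> - y n)\<^sup>2)) \<le>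
        U i (r n) (x n) - (\<eta> / (T - r n) + 1 / (2 * \<epsilon>) * (r n - s n)\<^sup>2 + 1 * (r n - r0)\<^sup>2 +
          (\<alpha> * (x n - 0)\<^sup>2 + 1 * (x n - x0)\<^sup>2 + real (\<phi> n) / 2 * (x n - y n)\<^sup>2))"
        using zm[of t "s n" \<xi> "y n"] e by (simp add: G_def Q_def)
    qed
    then have 1: "H i (P n + q n) \<le> A n"
      by (simp add: P_def q_def A_def algebra_simps diff_divide_distrib)
    have "(\<eta> / (T - s n)\<^sup>2 + 2 * (1 / (2 * \<epsilon>)) * (s n - r n)) + 2 * 1 * (s n - s0) +
        Hd i (2 * (real (\<phi> n) / 2) * (y n - x n)) \<le> 0"
    proof (rule W.branch_test[OF C1_time_add[OF C1_time_add[OF C1_time_reciprocal C1_time_square] C1_time_square]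
          C1_half_square in_T(3,4,6) e])
      fix t \<xi> assume "\<bar>t - s n\<bar> < e" "\<bar>\<xi> - y n\<bar> < e"
      then show "W i t \<xi> - (\<eta> / (T - t) + 1 / (2 * \<epsilon>) * (t - r n)\<^sup>2 + 1 * (t - s0)\<^sup>2 +
          real (\<phi> n) / 2 * (\<xi> - x n)\<^sup>2) \<le>
        W i (s n) (y n) - (\<eta> / (T - s n) + 1 / (2 * \<epsilon>) * (s n - r n)\<^sup>2 + 1 * (s n - s0)\<^sup>2 +
          real (\<phi> n) / 2 * (y n - x n)\<^sup>2)"
        using zm[of "r n" t "x n" \<xi>] e by (simp add: G_def Q_def power2_commute)
    qed
    then have "Hd i (- P n) \<le> B n"
      by (simp add: P_def B_def algebra_simps diff_divide_distrib)
    with 1 show ?case by simp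
  qed
  have ne: "T - r0 \<noteq> 0" "T - s0 \<noteq> 0" "\<epsilon> \<noteq> 0" using r0 s0 \<epsilon> by auto
  have limA: "A \<longlonglongrightarrow> - (\<eta> / (T - r0)\<^sup>2 + (r0 - s0) / \<epsilon> + 2 * (r0 - r0))"
    unfolding A_def by (intro tendsto_intros lim) (use ne in auto)
  have limB: "B \<longlonglongrightarrow> - (\<eta> / (T - s0)\<^sup>2 + (s0 - r0) / \<epsilon> + 2 * (s0 - s0))"
    unfolding B_def by (intro tendsto_intros lim) (use ne in auto)
  have limq: "q \<longlonglongrightarrow> 2 * \<alpha> * x0 + 2 * (x0 - x0)"
    unfolding q_def by (intro tendsto_intros lim)
  obtain CA Cq where C: "\<And>n. \<bar>A n\<bar> \<le> CA" "\<And>n. \<bar>q n\<bar> \<le> Cq"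
    using convergent_imp_Bseq[OF convergentI[OF limA]] convergent_imp_Bseq[OF convergentI[OF limq]]
    unfolding Bseq_def by (auto simp: real_norm_def)
  obtain R where R: "\<And>p. R \<le> \<bar>p\<bar> \<Longrightarrow> CA < H i p" using coercive_bound[OF co, of CA] by blast
  obtain m where m: "\<And>n. n \<ge> m \<Longrightarrow> H i (P n + q n) \<le> A n \<and> Hd i (- P n) \<le> B n"
    using ineq by (auto simp: eventually_sequentially)
  have "\<bar>P (n + m)\<bar> \<le> R + Cq" for n
  proof -
    have "\<not> R \<le> \<bar>P (n + m) + q (n + m)\<bar>"
      using R[of "P (n + m) + q (n + m)"] m[of "n + m"] C(1)[of "n + m"] by (auto simp: abs_le_iff)
    then show ?thesis using C(2)[of "n + m"] by linarith
  qed
  then have "bounded (range (\<lambda>n. P (n + m)))" by (auto simp: bounded_iff)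
  then obtain L \<psi> where L: "strict_mono \<psi>" "((\<lambda>n. P (n + m)) \<circ> \<psi>) \<longlonglongrightarrow> L"
    using bounded_imp_convergent_subsequence by blast
  have LP: "(\<lambda>n. P (\<psi> n + m)) \<longlonglongrightarrow> L" using L(2) by (simp add: o_def)
  have sub: "(\<lambda>n. X (\<psi> n + m)) \<longlonglongrightarrow> c" if "X \<longlonglongrightarrow> c" for X :: "nat \<Rightarrow> real" and c
    using LIMSEQ_subseq_LIMSEQ[OF LIMSEQ_ignore_initial_segment[OF that, of m] L(1)] by (simp add: o_def)
  have "(\<lambda>n. H i (P (\<psi> n + m) + q (\<psi> n + m))) \<longlonglongrightarrow> H i (L + (2 * \<alpha> * x0 + 2 * (x0 - x0)))"
    by (rule continuous_on_tendsto_compose[OF cont(1)]) (use LP sub[OF limq] in \<open>auto intro: tendsto_add\<close>)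
  from tendsto_le[OF sequentially_bot sub[OF limA] this]
  have 1: "H i (L + 2 * \<alpha> * x0) \<le> - (\<eta> / (T - r0)\<^sup>2 + (r0 - s0) / \<epsilon>)" using m by simp
  have "(\<lambda>n. Hd i (- P (\<psi> n + m))) \<longlonglongrightarrow> Hd i (- L)"
    by (rule continuous_on_tendsto_compose[OF cont(2)]) (use LP in \<open>auto intro: tendsto_minus\<close>)
  from tendsto_le[OF sequentially_bot sub[OF limB] this]
  have 2: "Hd i (- L) \<le> - (\<eta> / (T - s0)\<^sup>2 + (s0 - r0) / \<epsilon>)" using m by simp
  from 1 2 show ?thesis by blast
qed

section \<open>Flux-limited junction functions and comparison\<close>

lemma dec_part_le:
  assumes "turning_point h p0" shows "dec_part h q \<le> h q"
  using assms unfolding dec_part_eq[OF assms] by (auto simp: turning_point_def monotone_on_def)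

lemma flux_limited_le:
  assumes tp: "\<And>i. \<exists>p0. turning_point (H i) p0" and A: "A \<le> ereal k" and H: "\<And>i. H i (p i) \<le> k"
  shows "flux_limited H A p \<le> k"
proof -
  have "dec_part (H i) (p i) \<le> k" for i using dec_part_le tp H by (meson order_trans)
  then have "(MAX i. dec_part (H i) (p i)) \<le> k" by simp
  then have "max A (ereal (MAX i. dec_part (H i) (p i))) \<le> ereal k" using A by simp
  moreover have "max A (ereal (MAX i. dec_part (H i) (p i))) \<noteq> - \<infinity>"
    by (cases A) (auto simp: max_def)
  ultimately show ?thesis
    unfolding flux_limited_def by (cases "max A (ereal (MAX i. dec_part (H i) (p i)))") auto
qed

lemma flux_limited_ge:
  assumes "A \<noteq> \<infinity>"
  shows "A \<le> ereal (flux_limited H A p)" "dec_part (H i) (p i) \<le> flux_limited H A p"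
proof -
  have "max A (ereal (MAX i. dec_part (H i) (p i))) = ereal (flux_limited H A p)"
    using assms unfolding flux_limited_def by (cases A) (auto simp: max_def)
  then have le: "A \<le> ereal (flux_limited H A p)" "(MAX i. dec_part (H i) (p i)) \<le> flux_limited H A p"
    by (metis max.cobounded1, metis max.cobounded2 ereal_less_eq(3))
  show "A \<le> ereal (flux_limited H A p)" by (rule le)
  have "dec_part (H i) (p i) \<le> (MAX i. dec_part (H i) (p i))" by simp
  with le(2) show "dec_part (H i) (p i) \<le> flux_limited H A p" by simp
qed

lemma finite_upper:
  fixes R :: "'n::finite \<Rightarrow> real" obtains M where "M > 0" "\<And>i. R i \<le> M"
proof -
  have "R i \<le> max 1 (Max (range R))" for i by (simp add: le_max_iff_disj)
  then show ?thesis using that[of "max 1 (Max (range R))"] by simp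
qed

lemma finite_lower:
  fixes R :: "'n::finite \<Rightarrow> real" assumes "\<And>i. R i > 0" obtains m where "m > 0" "\<And>i. m \<le> R i"
  using that[of "Min (range R)"] assms by simp

locale flux_limited_junction =
  fixes H :: "'n::finite \<Rightarrow> real \<Rightarrow> real" and A :: ereal and T :: real
  assumes cont: "\<And>i. continuous_on UNIV (H i)" and qc: "\<And>i. quasi_convex (H i)"
    and co: "\<And>i. coercive (H i)" and A: "A \<noteq> \<infinity>" and T: "T > 0"
begin

abbreviation F :: "('n \<Rightarrow> real) \<Rightarrow> real" where
  "F \<equiv> flux_limited H A"

lemma turning_point_exists: "\<exists>p0. turning_point (H i) p0"
  by (rule ex_turning_point[OF cont qc co])

lemma F_le: "A \<le> ereal k \<Longrightarrow> (\<And>i. H i (p i) \<le> k) \<Longrightarrow> F p \<le> k"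
  by (rule flux_limited_le[OF turning_point_exists])

text \<open>
  For small slopes the decreasing part is the Hamiltonian itself and inherits its coercivity.
\<close>

lemma F_lower: "\<exists>R. \<forall>p. p i \<le> R \<longrightarrow> B < F p"
proof -
  obtain p0 where p0: "turning_point (H i) p0" using turning_point_exists by blast
  obtain R where R: "\<And>p. R \<le> \<bar>p\<bar> \<Longrightarrow> B < H i p" using coercive_bound[OF co] by blast
  have "B < F p" if "p i \<le> min p0 (- \<bar>R\<bar>)" for p
  proof -
    have "B < H i (p i)" by (rule R) (use that in auto)
    also have "H i (p i) = dec_part (H i) (p i)" using that by (simp add: dec_part_eq[OF p0])
    also have "\<dots> \<le> F p" by (rule flux_limited_ge[OF A])
    finally show ?thesis .
  qed
  then show ?thesis by blast
qed

lemma bounds: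
  assumes "L > 0"
  obtains K where "K > 0" "\<And>p. (\<And>j. \<bar>p j\<bar> \<le> L) \<Longrightarrow> \<bar>F p\<bar> \<le> K" "\<And>j p. \<bar>p\<bar> \<le> L \<Longrightarrow> \<bar>H j p\<bar> \<le> K"
proof -
  have "\<exists>B. \<forall>p. \<bar>p\<bar> \<le> L \<longrightarrow> \<bar>H j p\<bar> \<le> B" for j
  proof -
    have "bounded (H j ` {- L..L})"
      by (intro compact_imp_bounded compact_continuous_image continuous_on_subset[OF cont]) auto
    then obtain B where "\<forall>x\<in>{- L..L}. \<bar>H j x\<bar> \<le> B" by (auto simp: bounded_iff)
    then show ?thesis by (intro exI[of _ B]) (auto simp: abs_le_iff)
  qed
  then obtain B where B: "\<And>j p. \<bar>p\<bar> \<le> L \<Longrightarrow> \<bar>H j p\<bar> \<le> B j" by metis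
  obtain m where m: "\<And>j. turning_point (H j) (m j)" using turning_point_exists by metis
  obtain M1 where M1: "\<And>j. B j \<le> M1" using finite_upper[of B] by metis
  obtain M2 where M2: "M2 > 0" "\<And>j. - H j (m j) \<le> M2" using finite_upper[of "\<lambda>j. - H j (m j)"] by metis
  obtain M3 where M3: "A \<le> ereal M3" using A by (cases A) auto
  define K where "K = max M1 (max M2 M3)"
  show ?thesis
  proof (rule that)
    show "K > 0" using M2 by (simp add: K_def less_max_iff_disj)
    show HK: "\<bar>H j p\<bar> \<le> K" if "\<bar>p\<bar> \<le> L" for j p
      using B[OF that, of j] M1[of j] by (simp add: K_def le_max_iff_disj)
    show "\<bar>F p\<bar> \<le> K" if p: "\<And>j. \<bar>p j\<bar> \<le> L" for p
    proof -
      have "M3 \<le> K" by (simp add: K_def)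
      then have "A \<le> ereal K" using M3 by (meson ereal_less_eq(3) order_trans)
      then have "F p \<le> K" using HK[OF p] by (intro F_le) (auto simp: abs_le_iff)
      moreover have "- K \<le> F p"
      proof -
        fix j :: 'n
        have "- K \<le> H j (m j)" using M2(2)[of j] by (simp add: K_def)
        also have "\<dots> \<le> dec_part (H j) (p j)"
          using m[of j] by (auto simp: dec_part_eq[OF m] turning_point_def monotone_on_def)
        also have "\<dots> \<le> F p" by (rule flux_limited_ge[OF A])
        finally show ?thesis .
      qed
      ultimately show ?thesis by simp
    qed
  qed
qed

text \<open>
  On a sub-level set of \<open>H i\<close>, which is bounded, a small change of the slope changes \<open>H i\<close> by less
  than \<open>c\<close>. This absorbs the slope of the penalisation at infinity.
\<close>

lemma uniform_shift:
  assumes "c > 0"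
  obtains \<tau> where "\<tau> > 0"
    "\<And>i P d. 0 \<le> d \<Longrightarrow> d \<le> \<tau> \<Longrightarrow> H i (P + d) \<le> B \<Longrightarrow> H i P < H i (P + d) + c"
proof -
  have "\<exists>\<tau>>0. \<forall>P d. 0 \<le> d \<longrightarrow> d \<le> \<tau> \<longrightarrow> H i (P + d) \<le> B \<longrightarrow> H i P < H i (P + d) + c" for i
  proof -
    obtain R where R: "\<And>p. R \<le> \<bar>p\<bar> \<Longrightarrow> B < H i p" using coercive_bound[OF co] by blast
    have "uniformly_continuous_on {- R - 1..R + 1} (H i)"
      by (intro compact_uniformly_continuous continuous_on_subset[OF cont]) auto
    then obtain d0 where d0: "d0 > 0" "\<And>x y. x \<in> {- R - 1..R + 1} \<Longrightarrow> y \<in> {- R - 1..R + 1} \<Longrightarrow>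
        dist y x < d0 \<Longrightarrow> dist (H i y) (H i x) < c"
      using assms unfolding uniformly_continuous_on_def by metis
    have "H i P < H i (P + d) + c" if "0 \<le> d" "d \<le> min 1 (d0 / 2)" "H i (P + d) \<le> B" for P d
    proof -
      have "\<not> R \<le> \<bar>P + d\<bar>" using R[of "P + d"] that by auto
      then have "dist (H i P) (H i (P + d)) < c"
        using that d0(1) by (intro d0(2)) (auto simp: dist_real_def)
      then show ?thesis by (auto simp: dist_real_def abs_less_iff)
    qed
    then show ?thesis using d0(1) by (intro exI[of _ "min 1 (d0 / 2)"]) auto
  qed
  then obtain \<tau> where \<tau>: "\<And>i. \<tau> i > 0" "\<And>i P d. 0 \<le> d \<Longrightarrow> d \<le> \<tau> i \<Longrightarrow> H i (P + d) \<le> B \<Longrightarrow> H i P < H i (P + d) + c"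
    by metis
  obtain m where m: "m > 0" "\<And>i. m \<le> \<tau> i" using finite_lower[of \<tau>] \<tau>(1) by blast
  show ?thesis by (rule that[OF m(1)]) (use \<tau>(2) m(2) in \<open>meson order_trans\<close>)
qed

context
  fixes U W :: "'n \<Rightarrow> real \<Rightarrow> real \<Rightarrow> real"
  assumes U: "junction_subsolution T H F U"
    and W: "junction_subsolution T (\<lambda>i p. - H i (- p)) (\<lambda>p. - F (\<lambda>i. - p i)) W"
begin

interpretation U: junction_subsolution T H F U by (rule U)
interpretation W: junction_subsolution T "\<lambda>i p. - H i (- p)" "\<lambda>p. - F (\<lambda>i. - p i)" W by (rule W)

text \<open>
  The slopes \<open>p\<close> of \<open>vertex_slopes\<close> are lower slopes of the sub-solution \<open>U\<close>. At a maximum of \<open>U +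
  W\<close> the super-solution \<open>- W\<close> lies above \<open>U\<close> up to penalties, hence above the lines of slope \<open>p i
  - \<delta>\<close>, and may be tested with them. But \<open>H i (p i)\<close> and \<open>A\<close> are strictly below the value required
  by the super-solution, and \<open>F\<close> is at most the maximum of these numbers.
\<close>

lemma no_maximum_at_vertex:
  assumes r0: "0 < r0" "r0 < T" and s0: "0 < s0" "s0 < T" and \<epsilon>: "\<epsilon> > 0" and \<eta>: "\<eta> > 0"
    and max: "\<And>i r s x. 0 < r \<Longrightarrow> r < T \<Longrightarrow> 0 < s \<Longrightarrow> s < T \<Longrightarrow> 0 \<le> x \<Longrightarrow>
       U i r x + W i s x - (\<eta> / (T - r) + \<eta> / (T - s) + 1 / (2 * \<epsilon>) * (r - s)\<^sup>2 + \<alpha> * x\<^sup>2) \<le>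
       U k r0 0 + W k s0 0 - (\<eta> / (T - r0) + \<eta> / (T - s0) + 1 / (2 * \<epsilon>) * (r0 - s0)\<^sup>2)"
  shows False
proof -
  define c where "c = (r0 - s0) / \<epsilon>"
  \<comment> \<open>The mixed square \<open>(r - s)\<^sup>2 / (2 * \<epsilon>)\<close> is bounded by a sum of a function of \<open>r\<close> and
    one of \<open>s\<close> (see \<open>square\<close>). The coefficient \<open>1 / \<epsilon>\<close>, twice the one in the penalty,
    pays for the splitting and also makes the maximum in \<open>r\<close> strict.\<close>
  define a where "a t = \<eta> / (T - t) + c * (t - r0) + 1 / \<epsilon> * (t - r0)\<^sup>2" for t
  define a' where "a' t = \<eta> / (T - t)\<^sup>2 + c + 2 * (1 / \<epsilon>) * (t - r0)" for t
  have a: "C1_time T a a'" unfolding a_def a'_def by (rule C1_time_penalty)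
  define \<rho> where "\<rho> = min r0 (T - r0) / 2"
  have \<rho>: "\<rho> > 0" "0 < r0 - \<rho>" "r0 + \<rho> < T" using r0 by (auto simp: \<rho>_def min_def field_simps)
  have square: "1 / (2 * \<epsilon>) * (r - s)\<^sup>2 \<le> 1 / (2 * \<epsilon>) * (r0 - s0)\<^sup>2 + c * (r - r0) - c * (s - s0)
      + 1 / \<epsilon> * (r - r0)\<^sup>2 + 1 / \<epsilon> * (s - s0)\<^sup>2" for r s
  proof -
    have "(r - s)\<^sup>2 + ((r - r0) + (s - s0))\<^sup>2 = (r0 - s0)\<^sup>2 + 2 * (r0 - s0) * (r - r0) - 2 * (r0 - s0) * (s - s0)
      + 2 * (r - r0)\<^sup>2 + 2 * (s - s0)\<^sup>2"
      by (simp add: power2_eq_square algebra_simps)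
    then have "(r - s)\<^sup>2 \<le> (r0 - s0)\<^sup>2 + 2 * (r0 - s0) * (r - r0) - 2 * (r0 - s0) * (s - s0)
      + 2 * (r - r0)\<^sup>2 + 2 * (s - s0)\<^sup>2"
      using zero_le_power2[of "(r - r0) + (s - s0)"] by linarith
    then have "1 / (2 * \<epsilon>) * (r - s)\<^sup>2 \<le> 1 / (2 * \<epsilon>) * ((r0 - s0)\<^sup>2 + 2 * (r0 - s0) * (r - r0)
      - 2 * (r0 - s0) * (s - s0) + 2 * (r - r0)\<^sup>2 + 2 * (s - s0)\<^sup>2)"
      using \<epsilon> by (intro mult_left_mono) auto
    also have "\<dots> = 1 / (2 * \<epsilon>) * (r0 - s0)\<^sup>2 + c * (r - r0) - c * (s - s0)
      + 1 / \<epsilon> * (r - r0)\<^sup>2 + 1 / \<epsilon> * (s - s0)\<^sup>2"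
      using \<epsilon> by (simp add: c_def field_simps)
    finally show ?thesis .
  qed
  have Uk: "U undefined r0 0 = U k r0 0" by (rule U.vertex_eq)
  have strict: "U j r 0 - a r < U undefined r0 0 - a r0" if "\<bar>r - r0\<bar> \<le> \<rho>" "r \<noteq> r0" for j r
  proof -
    have "0 < r" "r < T" using that \<rho> by (auto simp: abs_le_iff)
    then have "U j r 0 - (\<eta> / (T - r) + 1 / (2 * \<epsilon>) * (r - s0)\<^sup>2) \<le>
        U k r0 0 - (\<eta> / (T - r0) + 1 / (2 * \<epsilon>) * (r0 - s0)\<^sup>2)"
      using max[of r s0 0 j] s0 W.vertex_eq[of j s0 k] by simp
    moreover have "1 / (2 * \<epsilon>) * (r - s0)\<^sup>2 = 1 / (2 * \<epsilon>) * (r0 - s0)\<^sup>2 + c * (r - r0) + 1 / (2 * \<epsilon>) * (r - r0)\<^sup>2"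
      using \<epsilon> by (simp add: c_def field_simps power2_eq_square)
    moreover have "1 / (2 * \<epsilon>) * (r - r0)\<^sup>2 < 1 / \<epsilon> * (r - r0)\<^sup>2"
      using \<epsilon> that(2) by (intro mult_strict_right_mono) (auto simp: field_simps)
    ultimately show ?thesis unfolding Uk a_def by simp
  qed
  obtain q p where q: "F q \<le> - a' r0" and p: "\<And>i. H i (p i) \<le> - a' r0"
    and slope: "\<And>i \<delta>. \<delta> > 0 \<Longrightarrow> \<exists>\<sigma>>0. \<forall>s. 0 < s \<longrightarrow> s \<le> \<sigma> \<longrightarrow>
       (\<exists>r. \<bar>r - r0\<bar> \<le> \<rho> \<and> U undefined r0 0 - a r0 + (p i - \<delta>) * s \<le> U i r s - a r)"
    using U.vertex_slopes[OF a \<rho> strict cont co F_lower] by blast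
  have a'r0: "- a' r0 < - c" using \<eta> r0 by (simp add: a'_def)
  have "A \<le> ereal (F q)" by (rule flux_limited_ge[OF A])
  also have "\<dots> \<le> ereal (- c)" using q a'r0 by simp
  finally have Ac: "A \<le> ereal (- c)" .
  have "\<exists>\<delta>>0. \<forall>d. 0 < d \<longrightarrow> d \<le> \<delta> \<longrightarrow> H i (p i - d) < - c" for i
  proof -
    have "isCont (H i) (p i)" using cont by (simp add: continuous_on_eq_continuous_at)
    moreover have "- c - H i (p i) > 0" using p[of i] a'r0 by simp
    ultimately obtain d where d: "d > 0" "\<And>x. \<bar>x - p i\<bar> < d \<Longrightarrow> \<bar>H i x - H i (p i)\<bar> < - c - H i (p i)"
      unfolding continuous_at_eps_delta dist_real_def by metis
    have "H i (p i - x) < - c" if "0 < x" "x \<le> d / 2" for x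
      using d(2)[of "p i - x"] that d(1) by (simp add: abs_less_iff)
    then show ?thesis using d(1) by (intro exI[of _ "d / 2"]) auto
  qed
  then obtain \<Delta> where \<Delta>: "\<And>i. \<Delta> i > 0" "\<And>i d. 0 < d \<Longrightarrow> d \<le> \<Delta> i \<Longrightarrow> H i (p i - d) < - c"
    by metis
  obtain \<delta> where \<delta>: "\<delta> > 0" "\<And>i. \<delta> \<le> \<Delta> i" using finite_lower[of \<Delta>] \<Delta>(1) by blast
  have H\<delta>: "H i (p i - \<delta>) < - c" for i by (rule \<Delta>(2)[OF \<delta>])
  obtain \<Sigma> where \<Sigma>: "\<And>i. \<Sigma> i > 0" "\<And>i s. 0 < s \<Longrightarrow> s \<le> \<Sigma> i \<Longrightarrow>
       \<exists>r. \<bar>r - r0\<bar> \<le> \<rho> \<and> U undefined r0 0 - a r0 + (p i - \<delta>) * s \<le> U i r s - a r"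
    using slope[OF \<delta>(1)] by metis
  obtain \<sigma> where \<sigma>: "\<sigma> > 0" "\<And>i. \<sigma> \<le> \<Sigma> i" using finite_lower[of \<Sigma>] \<Sigma>(1) by blast
  have lower: "\<exists>r. \<bar>r - r0\<bar> \<le> \<rho> \<and> U undefined r0 0 - a r0 + (p i - \<delta>) * x \<le> U i r x - a r"
    if "0 \<le> x" "x < \<sigma>" for i x
  proof (cases "x = 0")
    case True
    then show ?thesis using \<rho> U.vertex_eq[of undefined r0 i] by (intro exI[of _ r0]) simp
  next
    case False
    then show ?thesis using \<Sigma>(2)[of x i] \<sigma>(2)[of i] that by auto
  qed
  define b where "b t = \<eta> / (T - t) + (- c) * (t - s0) + 1 / \<epsilon> * (t - s0)\<^sup>2" for t
  define b' where "b' t = \<eta> / (T - t)\<^sup>2 + (- c) + 2 * (1 / \<epsilon>) * (t - s0)" for t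
  have b: "C1_time T b b'" unfolding b_def b'_def by (rule C1_time_penalty)
  define g where "g i x = \<alpha> * x\<^sup>2 + - (p i - \<delta>) * x + 0" for i x
  define g' where "g' i x = 2 * \<alpha> * x + - (p i - \<delta>)" for i x
  have g: "C1_half (g i) (g' i)" for i unfolding g_def g'_def by (rule C1_half_quadratic)
  have "b' s0 + - F (\<lambda>i. - g' i 0) \<le> 0 \<or> (\<exists>i. b' s0 + - H i (- g' i 0) \<le> 0)"
  proof (rule W.vertex_test[where g = g and g' = g' and k = k, OF b g _ s0 \<sigma>(1)])
    show "g i 0 = g j 0" for i j by (simp add: g_def)
    fix t i x assume t: "0 < t" "t < T" and x: "0 \<le> x" "x < \<sigma>"
    obtain r where r: "\<bar>r - r0\<bar> \<le> \<rho>" "U undefined r0 0 - a r0 + (p i - \<delta>) * x \<le> U i r x - a r"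
      using lower[OF x] by blast
    have "0 < r" "r < T" using r(1) \<rho> by (auto simp: abs_le_iff)
    from max[OF this t x(1), of i] r(2) square[of r t]
    show "W i t x - (b t + g i x) \<le> W k s0 0 - (b s0 + g k 0)"
      unfolding Uk by (simp add: a_def b_def g_def algebra_simps)
  qed
  moreover have "b' s0 > - c" using \<eta> s0 by (simp add: b'_def)
  moreover have "F (\<lambda>i. - g' i 0) \<le> - c"
    by (rule F_le[OF Ac]) (use H\<delta> in \<open>simp add: g'_def less_imp_le\<close>)
  moreover have "H i (- g' i 0) < - c" for i using H\<delta>[of i] by (simp add: g'_def)
  ultimately show False by (smt (verit))
qed

text \<open>
  Since \<open>U\<close> and \<open>W\<close> are bounded by \<open>d\<close> and \<open>- d\<close> up to \<open>\<theta> + K t\<close>, their sum is bounded above, and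
  it is small when one of the two times is \<open>0\<close>. So the penalised maximum is attained at positive
  times. If it lies at the vertex, \<open>no_maximum_at_vertex\<close> applies; otherwise \<open>interior_doubling\<close>
  applies, and the slope \<open>2 * \<alpha> * x0\<close> is harmless because \<open>\<alpha> * x0\<^sup>2 \<le> B\<close> makes it at most \<open>2 *
  sqrt (\<alpha> * B)\<close>.
\<close>

lemma comparison:
  fixes d :: "'n \<Rightarrow> real \<Rightarrow> real"
  assumes est: "\<And>\<theta>. \<theta> > 0 \<Longrightarrow> \<exists>K\<ge>0. \<forall>i t x. 0 \<le> t \<longrightarrow> t < T \<longrightarrow> 0 \<le> x \<longrightarrow>
      U i t x \<le> d i x + \<theta> + K * t \<and> W i t x \<le> - d i x + \<theta> + K * t"
    and t1: "0 \<le> t1" "t1 < T" and x1: "0 \<le> x1"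
  shows "U i1 t1 x1 + W i1 t1 x1 \<le> 0"
proof (rule ccontr)
  assume pos: "\<not> U i1 t1 x1 + W i1 t1 x1 \<le> 0"
  define \<theta> where "\<theta> = (U i1 t1 x1 + W i1 t1 x1) / 6"
  have \<theta>: "\<theta> > 0" "U i1 t1 x1 + W i1 t1 x1 = 6 * \<theta>" using pos by (auto simp: \<theta>_def)
  obtain K where K: "K \<ge> 0" and estU: "\<And>i t x. 0 \<le> t \<Longrightarrow> t < T \<Longrightarrow> 0 \<le> x \<Longrightarrow> U i t x \<le> d i x + \<theta> + K * t"
    and estW: "\<And>i t x. 0 \<le> t \<Longrightarrow> t < T \<Longrightarrow> 0 \<le> x \<Longrightarrow> W i t x \<le> - d i x + \<theta> + K * t"
    using est[OF \<theta>(1)] by blast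
  define B where "B = 2 * \<theta> + 2 * (K * T)"
  have B: "B > 0" using \<theta> K T by (simp add: B_def add_pos_nonneg)
  have sumB: "U i r x + W i s x \<le> B" if "0 \<le> r" "r < T" "0 \<le> s" "s < T" "0 \<le> x" for i r s x
  proof -
    have "K * r \<le> K * T" "K * s \<le> K * T" using that K by (auto intro: mult_left_mono)
    then show ?thesis using estU[of r x i] estW[of s x i] that by (simp add: B_def)
  qed
  \<comment> \<open>The order of the choices matters: \<open>\<eta>\<close>, then \<open>\<epsilon>\<close> (which bounds the time slopes by \<open>T
    / \<epsilon>\<close>), then \<open>\<tau>\<close>, and \<open>\<alpha>\<close> last.\<close>
  define \<eta> where "\<eta> = \<theta> / 2 * (T - t1)"
  have \<eta>: "\<eta> > 0" using \<theta> t1 by (simp add: \<eta>_def)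
  have \<eta>1: "\<eta> / (T - t1) = \<theta> / 2"
    using t1 unfolding \<eta>_def by (intro nonzero_mult_div_cancel_right) simp
  \<comment> \<open>The two times of the maximum will differ by at most \<open>\<nu>\<close>. If one of them is \<open>0\<close>, then
    \<open>U + W\<close> is at most \<open>2 * \<theta> + K * \<nu> \<le> 3 * \<theta>\<close> there, whereas the maximum is at least \<open>4
    * \<theta>\<close>.\<close>
  define \<nu> where "\<nu> = \<theta> / (K + 1)"
  have \<nu>: "\<nu> > 0" "K * \<nu> \<le> \<theta>" using \<theta> K by (auto simp: \<nu>_def field_simps)
  define \<epsilon> where "\<epsilon> = \<nu>\<^sup>2 / (2 * B)"
  have \<epsilon>: "\<epsilon> > 0" using \<nu> B by (simp add: \<epsilon>_def)
  have "\<eta> / T\<^sup>2 > 0" using \<eta> T by simp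
  then obtain \<tau> where \<tau>: "\<tau> > 0" "\<And>i P d. 0 \<le> d \<Longrightarrow> d \<le> \<tau> \<Longrightarrow> H i (P + d) \<le> T / \<epsilon> \<Longrightarrow>
      H i P < H i (P + d) + \<eta> / T\<^sup>2"
    using uniform_shift[of "\<eta> / T\<^sup>2" "T / \<epsilon>"] by blast
  define \<alpha> where "\<alpha> = min (\<theta> / (x1\<^sup>2 + 1)) (\<tau>\<^sup>2 / (4 * B))"
  have x1p: "x1\<^sup>2 + 1 > 0" by (simp add: add_nonneg_pos)
  have \<alpha>: "\<alpha> > 0" using \<theta> \<tau> B x1p by (simp add: \<alpha>_def)
  have \<alpha>1: "\<alpha> * x1\<^sup>2 \<le> \<theta>"
  proof -
    have "\<alpha> * x1\<^sup>2 \<le> \<alpha> * (x1\<^sup>2 + 1)" using \<alpha> by (intro mult_left_mono) auto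
    also have "\<dots> \<le> \<theta> / (x1\<^sup>2 + 1) * (x1\<^sup>2 + 1)"
      using x1p by (intro mult_right_mono) (auto simp: \<alpha>_def)
    finally show ?thesis using x1p by simp
  qed
  have \<alpha>2: "4 * \<alpha> * B \<le> \<tau>\<^sup>2"
  proof -
    have "4 * B * \<alpha> \<le> 4 * B * (\<tau>\<^sup>2 / (4 * B))" using B by (intro mult_left_mono) (auto simp: \<alpha>_def)
    then show ?thesis using B by (simp add: mult_ac)
  qed
  define \<Phi> where "\<Phi> i z = U i (fst (fst z)) (snd z) + W i (snd (fst z)) (snd z) -
      (\<eta> / (T - fst (fst z)) + \<eta> / (T - snd (fst z)) + 1 / (2 * \<epsilon>) * (fst (fst z) - snd (fst z))\<^sup>2
       + \<alpha> * (snd z)\<^sup>2)" for i and z :: "(real \<times> real) \<times> real"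
  have \<Phi>1: "4 * \<theta> \<le> \<Phi> i1 ((t1, t1), x1)"
    using \<alpha>1 \<theta>(2) unfolding \<Phi>_def fst_conv snd_conv \<eta>1 by simp
  define S where "S = ({0..<T} \<times> {0..<T}) \<times> {0::real..}"
  define \<kappa> where "\<kappa> = min (T - t1) (\<eta> / B)"
  have \<kappa>: "\<kappa> > 0" using t1 \<eta> B by (simp add: \<kappa>_def)
  define X where "X = max x1 (B / \<alpha> + 1)"
  define C where "C = ({0..T - \<kappa>} \<times> {0..T - \<kappa>}) \<times> {0..X}"
  have uscU: "usc_on S (\<lambda>z. U i (fst (fst z)) (snd z))" for i
    using usc_on_compose[OF U.usc, of S "\<lambda>z. (fst (fst z), snd z)" i]
    by (force simp: S_def intro!: continuous_intros)
  have uscW: "usc_on S (\<lambda>z. W i (snd (fst z)) (snd z))" for i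
    using usc_on_compose[OF W.usc, of S "\<lambda>z. (snd (fst z), snd z)" i]
    by (force simp: S_def intro!: continuous_intros)
  have terms: "r < T \<Longrightarrow> s < T \<Longrightarrow> \<eta> / (T - r) \<ge> 0 \<and> \<eta> / (T - s) \<ge> 0 \<and>
      1 / (2 * \<epsilon>) * (r - s)\<^sup>2 \<ge> 0 \<and> \<alpha> * x\<^sup>2 \<ge> 0" for r s x
    using \<eta> \<epsilon> \<alpha> by auto
  have "\<exists>i. \<exists>z\<in>C. \<forall>j. \<forall>y\<in>S. \<Phi> j y \<le> \<Phi> i z"
  proof (rule usc_family_attains_max_superlevel)
    show "usc_on S (\<Phi> i)" for i
      unfolding \<Phi>_def
      by (intro usc_on_diff_continuous usc_on_add uscU uscW continuous_intros) (auto simp: S_def)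
    show "compact C" unfolding C_def by (intro compact_Times compact_Icc)
    show in_C: "((t1, t1), x1) \<in> C" using t1 x1 by (auto simp: C_def \<kappa>_def X_def)
    then show "C \<noteq> {}" by blast
    show "C \<subseteq> S" using \<kappa> by (auto simp: C_def S_def)
    fix j and y :: "(real \<times> real) \<times> real"
    assume y: "y \<in> S" "y \<notin> C"
    obtain r s x where y_eq: "y = ((r, s), x)" by (metis surj_pair)
    have rsx: "0 \<le> r" "r < T" "0 \<le> s" "s < T" "0 \<le> x" using y(1) by (auto simp: S_def y_eq)
    have late: "\<eta> / (T - t) > B" if "t > T - \<kappa>" "t < T" for t
    proof -
      have "T - t < \<eta> / B" using that by (auto simp: \<kappa>_def)
      then show ?thesis using that B by (simp add: field_simps)
    qed
    have far: "\<alpha> * x\<^sup>2 > B" if "x > X"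
    proof -
      have x: "x > B / \<alpha> + 1" using that by (simp add: X_def)
      moreover have "B / \<alpha> > 0" using B \<alpha> by simp
      ultimately have "x * 1 \<le> x * x" by (intro mult_left_mono) auto
      then have "B / \<alpha> < x\<^sup>2" using x by (simp add: power2_eq_square)
      then show ?thesis using \<alpha> by (simp add: field_simps)
    qed
    have "r > T - \<kappa> \<or> s > T - \<kappa> \<or> x > X" using y(2) rsx by (auto simp: C_def y_eq)
    then have "B < \<eta> / (T - r) + \<eta> / (T - s) + 1 / (2 * \<epsilon>) * (r - s)\<^sup>2 + \<alpha> * x\<^sup>2"
      using late[of r] late[of s] far terms[of r s x] rsx by linarith
    then have "\<Phi> j y < 0" using sumB[OF rsx, of j] by (simp add: \<Phi>_def y_eq)
    then show "\<Phi> j y \<le> \<Phi> i1 ((t1, t1), x1)" using \<Phi>1 \<theta> by simp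
  qed
  then obtain j z where z: "z \<in> C" and maxz: "\<And>i y. y \<in> S \<Longrightarrow> \<Phi> i y \<le> \<Phi> j z" by blast
  obtain r0 s0 x0 where z_eq: "z = ((r0, s0), x0)" by (metis surj_pair)
  have rs: "0 \<le> r0" "r0 < T" "0 \<le> s0" "s0 < T" "0 \<le> x0" using z \<kappa> by (auto simp: C_def z_eq)
  have big: "4 * \<theta> \<le> \<Phi> j ((r0, s0), x0)"
    using maxz[of "((t1, t1), x1)" i1] \<Phi>1 t1 x1 by (simp add: S_def z_eq)
  note tm = terms[OF rs(2,4), of x0]
  have small: "1 / (2 * \<epsilon>) * (r0 - s0)\<^sup>2 \<le> B" "\<alpha> * x0\<^sup>2 \<le> B" "4 * \<theta> \<le> U j r0 x0 + W j s0 x0"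
    using big sumB[OF rs, of j] tm \<theta>(1) by (simp_all add: \<Phi>_def)
  have close: "\<bar>r0 - s0\<bar> \<le> \<nu>"
  proof -
    have "(r0 - s0)\<^sup>2 \<le> 2 * \<epsilon> * B" using small(1) \<epsilon> by (simp add: field_simps)
    also have "\<dots> = \<nu>\<^sup>2" using B by (simp add: \<epsilon>_def)
    finally show ?thesis using \<nu>(1) by (simp add: abs_le_square_iff[symmetric])
  qed
  have r0: "r0 > 0"
  proof (rule ccontr)
    assume "\<not> r0 > 0"
    then have "r0 = 0" "s0 \<le> \<nu>" using rs close by auto
    moreover have "K * s0 \<le> K * \<nu>" using K \<open>s0 \<le> \<nu>\<close> by (intro mult_left_mono)
    ultimately show False
      using estU[of 0 x0 j] estW[of s0 x0 j] rs small(3) \<nu>(2) \<theta>(1) T by simp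
  qed
  have s0: "s0 > 0"
  proof (rule ccontr)
    assume "\<not> s0 > 0"
    then have "s0 = 0" "r0 \<le> \<nu>" using rs close by auto
    moreover have "K * r0 \<le> K * \<nu>" using K \<open>r0 \<le> \<nu>\<close> by (intro mult_left_mono)
    ultimately show False
      using estW[of 0 x0 j] estU[of r0 x0 j] rs small(3) \<nu>(2) \<theta>(1) T by simp
  qed
  have max: "U i r x + W i s x - (\<eta> / (T - r) + \<eta> / (T - s) + 1 / (2 * \<epsilon>) * (r - s)\<^sup>2 + \<alpha> * x\<^sup>2) \<le>
       U j r0 x0 + W j s0 x0 - (\<eta> / (T - r0) + \<eta> / (T - s0) + 1 / (2 * \<epsilon>) * (r0 - s0)\<^sup>2 + \<alpha> * x0\<^sup>2)"
    if "0 < r" "r < T" "0 < s" "s < T" "0 \<le> x" for i r s x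
    using maxz[of "((r, s), x)" i] that by (simp add: \<Phi>_def S_def z_eq)
  show False
  proof (cases "x0 = 0")
    case True
    show False
      by (rule no_maximum_at_vertex[OF r0 rs(2) s0 rs(4) \<epsilon> \<eta>, where \<alpha> = \<alpha> and k = j])
        (use max True in simp)
  next
    case False
    then have x0: "x0 > 0" using rs by simp
    have contd: "continuous_on UNIV (\<lambda>p. - H j (- p))"
      by (intro continuous_intros continuous_on_compose2[OF cont]) auto
    obtain P where P: "H j (P + 2 * \<alpha> * x0) \<le> - (\<eta> / (T - r0)\<^sup>2 + (r0 - s0) / \<epsilon>)"
        "- H j (- (- P)) \<le> - (\<eta> / (T - s0)\<^sup>2 + (s0 - r0) / \<epsilon>)"
      using interior_doubling[OF U W cont contd co r0 rs(2) s0 rs(4) x0 \<epsilon>, of \<eta> \<alpha>] max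
      by (metis less_imp_le)
    have "(2 * \<alpha> * x0)\<^sup>2 \<le> \<tau>\<^sup>2"
    proof -
      have "(2 * \<alpha> * x0)\<^sup>2 = 4 * \<alpha> * (\<alpha> * x0\<^sup>2)" by (simp add: power2_eq_square)
      also have "\<dots> \<le> 4 * \<alpha> * B" using small(2) \<alpha> by (intro mult_left_mono) auto
      finally show ?thesis using \<alpha>2 by simp
    qed
    then have shift: "0 \<le> 2 * \<alpha> * x0" "2 * \<alpha> * x0 \<le> \<tau>"
      using \<alpha> x0 \<tau>(1) by (auto intro: power2_le_imp_le)
    have "(s0 - r0) / \<epsilon> \<le> T / \<epsilon>" using rs \<epsilon> by (intro divide_right_mono) auto
    moreover have "(r0 - s0) / \<epsilon> = - ((s0 - r0) / \<epsilon>)" by (simp add: diff_divide_distrib)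
    moreover have "\<eta> / (T - r0)\<^sup>2 \<ge> \<eta> / T\<^sup>2"
      using \<eta> rs by (intro divide_left_mono power_mono) auto
    moreover have "\<eta> / (T - s0)\<^sup>2 > 0" "\<eta> / T\<^sup>2 > 0" using \<eta> rs T by auto
    ultimately show False
      using P \<tau>(2)[OF shift, of j P] by simp
  qed
qed

end

end

theorem theorem1p5:
  fixes H :: "'n::finite \<Rightarrow> real \<Rightarrow> real"
    and A :: ereal
    and u0 :: "'n junction \<Rightarrow> real"
    and T C\<^sub>T :: real
    and u v :: "real \<times> 'n junction \<Rightarrow> real"
  assumes "\<And>i. continuous_on UNIV (H i)"
    and "\<And>i. quasi_convex (H i)"
    and "\<And>i. coercive (H i)"
    and "A \<noteq> \<infinity>"
    and "uniformly_continuous_on UNIV u0"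
    and "T > 0"
    and "relaxed_subsolution_from u0 T H (flux_limited H A) u"
    and "relaxed_supersolution_from u0 T H (flux_limited H A) v"
    and "C\<^sub>T > 0"
    and "\<And>t x. t \<in> {0..<T} \<Longrightarrow> u (t, x) \<le> C\<^sub>T * (1 + dist 0 x)"
    and "\<And>t x. t \<in> {0..<T} \<Longrightarrow> v (t, x) \<ge> - C\<^sub>T * (1 + dist 0 x)"
  shows "\<forall>t\<in>{0..<T}. \<forall>x. u (t, x) \<le> v (t, x)"
proof (intro ballI allI)
  fix t :: real and z :: "'n junction"
  assume t: "t \<in> {0..<T}"
  let ?S = "{0..<T} \<times> (UNIV :: 'n junction set)"
  let ?F = "flux_limited H A"
  let ?U = "\<lambda>i t s. usc_env ?S u (t, jpt i s)" and ?W = "\<lambda>i t s. - lsc_env ?S v (t, jpt i s)"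
  interpret flux_limited_junction H A T
    by unfold_locales (use assms(1-4,6) in auto)
  have u: "relaxed_subsolution T H ?F u" "usc_env ?S u (0, x) \<le> u0 x" for x
    using assms(7) by (auto simp: relaxed_subsolution_from_def)
  have v: "relaxed_supersolution T H ?F v" "u0 x \<le> lsc_env ?S v (0, x)" for x
    using assms(8) by (auto simp: relaxed_supersolution_from_def)
  have lbu: "locally_bounded_on ?S u" and lbv: "locally_bounded_on ?S (\<lambda>z. - v z)"
    using u(1) v(1) locally_bounded_on_minus
    by (auto simp: relaxed_subsolution_def relaxed_supersolution_def)
  have JU: "junction_subsolution T H ?F ?U"
    by (rule relaxed_subsolution_imp_junction_subsolution[OF u(1)])
  have JW: "junction_subsolution T (\<lambda>i p. - H i (- p)) (\<lambda>p. - ?F (\<lambda>i. - p i)) ?W"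
    by (rule relaxed_supersolution_imp_junction_subsolution[OF v(1)])
  have dist0: "dist 0 (jpt j s) = s" if "0 \<le> s" for j :: 'n and s
    using that by (simp add: dist_zero radius_jpt)
  have bcont: "continuous_on UNIV (\<lambda>z :: real \<times> 'n junction. C\<^sub>T * (1 + dist 0 (snd z)))"
    by (intro continuous_intros)
  have growthU: "?U j t s \<le> C\<^sub>T * (1 + s)" if "0 \<le> t" "t < T" "0 \<le> s" for j t s
    using usc_env_le_continuous[OF lbu bcont, of "(t, jpt j s)"] assms(10) that
    by (auto simp: dist0)
  have growthW: "?W j t s \<le> C\<^sub>T * (1 + s)" if "0 \<le> t" "t < T" "0 \<le> s" for j t s
  proof -
    have "- v z \<le> C\<^sub>T * (1 + dist 0 (snd z))" if "z \<in> ?S" for z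
      using assms(11)[of "fst z" "snd z"] that by auto
    from usc_env_le_continuous[OF lbv bcont this, of "(t, jpt j s)"] that
    show ?thesis by (simp add: dist0 lsc_env_eq)
  qed
  have est: "\<exists>K\<ge>0. \<forall>i t x. 0 \<le> t \<longrightarrow> t < T \<longrightarrow> 0 \<le> x \<longrightarrow>
      ?U i t x \<le> u0 (jpt i x) + \<theta> + K * t \<and> ?W i t x \<le> - u0 (jpt i x) + \<theta> + K * t"
    if \<theta>: "\<theta> > 0" for \<theta>
  proof -
    obtain L0 where L0: "L0 > 0" "\<And>x y. u0 x - u0 y \<le> \<theta> + L0 * dist x y"
      using uniformly_continuous_junction_modulus[OF assms(5) \<theta>] by blast
    define L where "L = max L0 (C\<^sub>T + 1)"
    have L: "L > 0" "L0 \<le> L" "C\<^sub>T < L" using L0 by (auto simp: L_def)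
    obtain K where K: "K > 0" "\<And>p. (\<And>j. \<bar>p j\<bar> \<le> L) \<Longrightarrow> \<bar>?F p\<bar> \<le> K" "\<And>j p. \<bar>p\<bar> \<le> L \<Longrightarrow> \<bar>H j p\<bar> \<le> K"
      using bounds[OF L(1)] by blast
    have mod: "u0 x - u0 y \<le> \<theta> + L * dist x y" for x y
      using L0(2)[of x y] mult_right_mono[OF L(2), of "dist x y"] by simp
    have dst: "dist (jpt j s) (jpt i x) = \<bar>s + (if j = i then - x else x)\<bar>" if "0 \<le> s" "0 \<le> x" for i j :: 'n and s x
      using that by (simp add: dist_jpt)
    have "?U i t x \<le> (u0 (jpt i x) + \<theta>) + K * t" if tx: "0 \<le> t" "t < T" "0 \<le> x" for i t x
    proof (rule junction_subsolution.barrier[OF JU, of C\<^sub>T L])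
      show "- K \<le> ?F p" if "\<And>j. \<bar>p j\<bar> \<le> L" for p using K(2)[of p] that by (simp add: abs_le_iff)
      show "- K \<le> H j p" if "\<bar>p\<bar> \<le> L" for j p using K(3)[OF that, of j] by (simp add: abs_le_iff)
      show "?U j 0 s \<le> u0 (jpt i x) + \<theta> + L * \<bar>s + (if j = i then - x else x)\<bar>" if "0 \<le> s" for j s
        using u(2)[of "jpt j s"] mod[of "jpt j s" "jpt i x"] unfolding dst[OF that tx(3)] by linarith
    qed (use assms(9) L K growthU tx in auto)
    moreover have "?W i t x \<le> (- u0 (jpt i x) + \<theta>) + K * t" if tx: "0 \<le> t" "t < T" "0 \<le> x" for i t x
    proof (rule junction_subsolution.barrier[OF JW, of C\<^sub>T L])
      show "- K \<le> - ?F (\<lambda>i. - p i)" if "\<And>j. \<bar>p j\<bar> \<le> L" for p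
        using K(2)[of "\<lambda>i. - p i"] that by (simp add: abs_le_iff)
      show "- K \<le> - H j (- p)" if "\<bar>p\<bar> \<le> L" for j p
        using K(3)[of "- p" j] that by (simp add: abs_le_iff)
      show "?W j 0 s \<le> - u0 (jpt i x) + \<theta> + L * \<bar>s + (if j = i then - x else x)\<bar>" if "0 \<le> s" for j s
        using v(2)[of "jpt j s"] mod[of "jpt i x" "jpt j s"]
        unfolding dst[OF that tx(3), symmetric] dist_commute[of "jpt i x"] by linarith
    qed (use assms(9) L K growthW tx in auto)
    ultimately show ?thesis using K(1) by (intro exI[of _ K]) auto
  qed
  obtain i x where x: "0 \<le> x" "z = jpt i x" by (rule jpt_cases)
  have "?U i t x + ?W i t x \<le> 0"
    using t x(1) by (intro comparison[OF JU JW est]) auto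
  moreover have "u (t, z) \<le> usc_env ?S u (t, z)" "- v (t, z) \<le> usc_env ?S (\<lambda>z. - v z) (t, z)"
    using t by (auto intro: le_usc_env[OF lbu] le_usc_env[OF lbv])
  ultimately show "u (t, z) \<le> v (t, z)" by (simp add: x(2) lsc_env_eq)
qed

end
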